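(* Let $G$ be a locally precompact abelian group. Then $\mathrm{Ext}(G,\prod_{p\in\mathbb{P}}\mathbb{Q}_p^{\alpha_p})$ is a divisible, torsion-free group for every collection of ordinal numbers $\alpha_p$, $p\in\mathbb{P}$.
   Context: All topological groups are Hausdorff and abelian. $\mathbb{P}$ is the set of prime numbers and $\mathbb{Q}_p$ the (additive topological group of) $p$-adic numbers; $\mathbb{Q}_p^{\alpha_p}$ is the product of copies of $\mathbb{Q}_p$ indexed by the ordinal $\alpha_p$, and products carry the product topology. A topological abelian group is locally precompact if its completion is locally compact. An extension of topological abelian groups is a short exact sequence $E:0\to H\stackrel{\imath}{\to}X\stackrel{\pi}{\to}G\to 0$ of topological abelian groups in which $\imath,\pi$ are continuous homomorphisms that are open onto their images. Two extensions $0\to H\stackrel{\imath}{\to}X\stackrel{\pi}{\to}G\to 0$ and $0\to H\stackrel{\imath'}{\to}X'\stackrel{\pi'}{\to}G\to 0$ are equivalent if there is a continuous homomorphism $T:X\to X'$ with $T\circ\imath=\imath'$ and $\pi'\circ T=\pi$ (such a $T$ is necessarily a topological isomorphism). $\mathrm{Ext}(G,H)$ is the set of equivalence classes of such extensions. It is an abelian group under the Baer sum: $[E_1]+[E_2]$ is the class of the extension obtained from the product extension $0\to H\times H\to X_1\times X_2\to G\times G\to 0$ by pulling back along the diagonal $G\to G\times G$ and then pushing out along the addition map $H\times H\to H$ (pull-backs and push-outs taken in topological abelian groups). The zero element is the class of the trivial extension $0\to H\to H\times G\to G\to 0$. *)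

theory Defs
  imports
    "HOL-Analysis.Analysis"
    "HOL-Algebra.Product_Groups"
    "HOL-Computational_Algebra.Primes"
begin

section \<open>Topological abelian groups\<close>

record 'a topgroup = "'a monoid" + topo :: "'a topology"

definition with_topology :: "'a monoid \<Rightarrow> 'a topology \<Rightarrow> 'a topgroup" where
  "with_topology M T = monoid.extend M (topgroup.fields T)"

lemma with_topology_simps [simp]:
  "carrier (with_topology M T) = carrier M"
  "monoid.mult (with_topology M T) = monoid.mult M"
  "one (with_topology M T) = one M"
  "topo (with_topology M T) = T"
  by (simp_all add: with_topology_def monoid.defs topgroup.defs)

text \<open>Groups are written multiplicatively, as everywhere in HOL-Algebra; Hausdorffness is part of
  the notion.\<close>

locale topological_ab_group = comm_group G for G :: "'a topgroup" (structure) +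
  assumes topspace_topo: "topspace (topo G) = carrier G"
    and Hausdorff_topo: "Hausdorff_space (topo G)"
    and continuous_mult: "continuous_map (prod_topology (topo G) (topo G)) (topo G) (\<lambda>(x, y). x \<otimes> y)"
    and continuous_inv: "continuous_map (topo G) (topo G) (m_inv G)"

definition top_hom :: "'a topgroup \<Rightarrow> 'b topgroup \<Rightarrow> ('a \<Rightarrow> 'b) set" where
  "top_hom G H = {f \<in> hom G H. continuous_map (topo G) (topo H) f}"

definition open_onto_image :: "'a topgroup \<Rightarrow> 'b topgroup \<Rightarrow> ('a \<Rightarrow> 'b) \<Rightarrow> bool" where
  "open_onto_image G H f \<longleftrightarrow> open_map (topo G) (subtopology (topo H) (f ` carrier G)) f"

definition top_DirProd :: "'a topgroup \<Rightarrow> 'b topgroup \<Rightarrow> ('a \<times> 'b) topgroup" where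
  "top_DirProd G H = with_topology (G \<times>\<times> H) (prod_topology (topo G) (topo H))"

definition top_product_group :: "'i set \<Rightarrow> ('i \<Rightarrow> 'a topgroup) \<Rightarrow> ('i \<Rightarrow> 'a) topgroup" where
  "top_product_group I G =
     with_topology (product_group I G) (product_topology (\<lambda>i. topo (G i)) I)"

definition top_subgroup :: "'a topgroup \<Rightarrow> 'a set \<Rightarrow> 'a topgroup" where
  "top_subgroup G S = G\<lparr>carrier := S, topo := subtopology (topo G) S\<rparr>"

definition quotient_topology :: "'a topology \<Rightarrow> ('a \<Rightarrow> 'b) \<Rightarrow> 'b topology" where
  "quotient_topology X q =
     topology (\<lambda>U. U \<subseteq> q ` topspace X \<and> openin X {x \<in> topspace X. q x \<in> U})"

lemma openin_quotient_topology:
  "openin (quotient_topology X q) U \<longleftrightarrow>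
     U \<subseteq> q ` topspace X \<and> openin X {x \<in> topspace X. q x \<in> U}"
proof -
  have "istopology (\<lambda>U. U \<subseteq> q ` topspace X \<and> openin X {x \<in> topspace X. q x \<in> U})"
    unfolding istopology_def
  proof (intro conjI allI impI)
    fix S T
    assume S: "S \<subseteq> q ` topspace X \<and> openin X {x \<in> topspace X. q x \<in> S}"
      and T: "T \<subseteq> q ` topspace X \<and> openin X {x \<in> topspace X. q x \<in> T}"
    show "S \<inter> T \<subseteq> q ` topspace X" using S by blast
    have "{x \<in> topspace X. q x \<in> S \<inter> T} = {x \<in> topspace X. q x \<in> S} \<inter> {x \<in> topspace X. q x \<in> T}"
      by auto
    then show "openin X {x \<in> topspace X. q x \<in> S \<inter> T}" using S T by (simp only: openin_Int)
  next
    fix \<K>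
    assume K: "\<forall>S\<in>\<K>. S \<subseteq> q ` topspace X \<and> openin X {x \<in> topspace X. q x \<in> S}"
    show "\<Union>\<K> \<subseteq> q ` topspace X" using K by blast
    have "{x \<in> topspace X. q x \<in> \<Union>\<K>} = (\<Union>S\<in>\<K>. {x \<in> topspace X. q x \<in> S})"
      by auto
    moreover have "openin X (\<Union>S\<in>\<K>. {x \<in> topspace X. q x \<in> S})"
      by (rule openin_Union) (use K in blast)
    ultimately show "openin X {x \<in> topspace X. q x \<in> \<Union>\<K>}" by (simp only:)
  qed
  then show ?thesis by (simp add: quotient_topology_def)
qed

lemma quotient_map_quotient_topology: "quotient_map X (quotient_topology X q) q"
proof -
  have "{x \<in> topspace X. q x \<in> q ` topspace X} = topspace X" by blast
  then have "openin (quotient_topology X q) (q ` topspace X)"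
    by (simp only: openin_quotient_topology) simp
  moreover have "topspace (quotient_topology X q) \<subseteq> q ` topspace X"
    using openin_topspace[of "quotient_topology X q"] unfolding openin_quotient_topology by blast
  ultimately have "topspace (quotient_topology X q) = q ` topspace X"
    using openin_subset subset_antisym by blast
  then show ?thesis
    unfolding quotient_map_def openin_quotient_topology by simp
qed

definition top_quotient_group :: "'a topgroup \<Rightarrow> 'a set \<Rightarrow> 'a set topgroup" where
  "top_quotient_group G N =
     with_topology (G Mod N) (quotient_topology (topo G) (\<lambda>x. N #>\<^bsub>G\<^esub> x))"


section \<open>Completions and local precompactness\<close>

definition cauchy_filter_on :: "'a topgroup \<Rightarrow> 'a filter \<Rightarrow> bool" where
  "cauchy_filter_on G F \<longleftrightarrow>
     F \<noteq> bot \<and> F \<le> principal (carrier G) \<and>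
     (\<forall>U. openin (topo G) U \<and> \<one>\<^bsub>G\<^esub> \<in> U \<longrightarrow>
          (\<forall>\<^sub>F (x, y) in F \<times>\<^sub>F F. x \<otimes>\<^bsub>G\<^esub> inv\<^bsub>G\<^esub> y \<in> U))"

definition complete_topgroup :: "'a topgroup \<Rightarrow> bool" where
  "complete_topgroup G \<longleftrightarrow>
     (\<forall>F. cauchy_filter_on G F \<longrightarrow> (\<exists>l. limitin (topo G) (\<lambda>x. x) l F))"

definition is_completion :: "'a topgroup \<Rightarrow> 'c topgroup \<Rightarrow> ('a \<Rightarrow> 'c) \<Rightarrow> bool" where
  "is_completion G C j \<longleftrightarrow>
     topological_ab_group C \<and> complete_topgroup C \<and>
     j \<in> hom G C \<and> embedding_map (topo G) (topo C) j \<and>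
     (topo C) closure_of (j ` carrier G) = carrier C"

text \<open>The completion of \<open>G\<close> is unique up to topological isomorphism and can be carried by the set
  of minimal Cauchy filters on \<open>G\<close>. It therefore always exists on the type \<open>'a filter\<close>, and
  quantifying over that type only is no restriction.\<close>

definition locally_precompact :: "'a topgroup \<Rightarrow> bool" where
  "locally_precompact G \<longleftrightarrow>
     (\<exists>(C :: 'a filter topgroup) j. is_completion G C j \<and> locally_compact_space (topo C))"


section \<open>Extensions\<close>

record ('h, 'x, 'g) extension =
  total :: "'x topgroup"
  incl :: "'h \<Rightarrow> 'x"
  proj :: "'x \<Rightarrow> 'g"

definition is_extension :: "'g topgroup \<Rightarrow> 'h topgroup \<Rightarrow> ('h, 'x, 'g) extension \<Rightarrow> bool" where
  "is_extension G H E \<longleftrightarrow>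
     topological_ab_group G \<and> topological_ab_group H \<and> topological_ab_group (total E) \<and>
     incl E \<in> top_hom H (total E) \<and> open_onto_image H (total E) (incl E) \<and>
     proj E \<in> top_hom (total E) G \<and> open_onto_image (total E) G (proj E) \<and>
     inj_on (incl E) (carrier H) \<and>
     incl E ` carrier H = kernel (total E) G (proj E) \<and>
     proj E ` carrier (total E) = carrier G"

definition ext_equiv ::
  "'g topgroup \<Rightarrow> 'h topgroup \<Rightarrow> ('h, 'x, 'g) extension \<Rightarrow> ('h, 'y, 'g) extension \<Rightarrow> bool" where
  "ext_equiv G H E E' \<longleftrightarrow>
     is_extension G H E \<and> is_extension G H E' \<and>
     (\<exists>T \<in> top_hom (total E) (total E').
        (\<forall>h \<in> carrier H. T (incl E h) = incl E' h) \<and>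
        (\<forall>x \<in> carrier (total E). proj E' (T x) = proj E x))"

text \<open>The underlying set of an extension of \<open>G\<close> by \<open>H\<close> is equipotent to \<open>H \<times> G\<close>, so every
  extension, whatever the type of its total group, is equivalent to one with total group in
  \<open>'h \<times> 'g\<close> (lemma \<open>ext_class_nonempty\<close> below). Equivalence classes are formed among these.\<close>

definition ext_class ::
  "'g topgroup \<Rightarrow> 'h topgroup \<Rightarrow> ('h, 'x, 'g) extension \<Rightarrow> ('h, 'h \<times> 'g, 'g) extension set" where
  "ext_class G H E = {E'. ext_equiv G H E E'}"

lemma ext_class_nonempty:
  assumes E: "is_extension G H E"
  shows "ext_class G H E \<noteq> {}"
proof -
  define X where "X = total E"
  define i where "i = incl E"
  define q where "q = proj E"
  have X: "topological_ab_group X" and G: "topological_ab_group G" and H: "topological_ab_group H"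
    and i: "i \<in> top_hom H X" and io: "open_onto_image H X i"
    and q: "q \<in> top_hom X G" and qo: "open_onto_image X G q"
    and inj: "inj_on i (carrier H)" and ker: "i ` carrier H = kernel X G q"
    and surj: "q ` carrier X = carrier G"
    using E by (simp_all add: is_extension_def X_def i_def q_def)
  interpret X: topological_ab_group X by (rule X)
  interpret G: topological_ab_group G by (rule G)
  have qh: "q \<in> hom X G" and qc: "continuous_map (topo X) (topo G) q"
    and ih: "i \<in> hom H X" and ic: "continuous_map (topo H) (topo X) i"
    using q i by (simp_all add: top_hom_def)
  interpret q: group_hom X G q by unfold_locales (rule qh)
  define s where "s = inv_into (carrier X) q"
  define \<phi> where "\<phi> = (\<lambda>x. (inv_into (carrier H) i (x \<otimes>\<^bsub>X\<^esub> inv\<^bsub>X\<^esub> (s (q x))), q x))"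
  have inj\<phi>: "inj_on \<phi> (carrier X)"
  proof (rule inj_onI)
    fix x y assume x: "x \<in> carrier X" and y: "y \<in> carrier X" and eq: "\<phi> x = \<phi> y"
    have qxy: "q x = q y" using eq by (simp add: \<phi>_def)
    have sq: "s (q z) \<in> carrier X \<and> q (s (q z)) = q z" if "z \<in> carrier X" for z
      using that unfolding s_def by (simp add: inv_into_into f_inv_into_f)
    have mem: "z \<otimes>\<^bsub>X\<^esub> inv\<^bsub>X\<^esub> (s (q z)) \<in> i ` carrier H" if "z \<in> carrier X" for z
      using that sq[OF that] by (simp add: ker kernel_def)
    have "inv_into (carrier H) i (x \<otimes>\<^bsub>X\<^esub> inv\<^bsub>X\<^esub> (s (q x)))
        = inv_into (carrier H) i (y \<otimes>\<^bsub>X\<^esub> inv\<^bsub>X\<^esub> (s (q y)))"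
      using eq unfolding \<phi>_def by (rule Pair_inject)
    then have "x \<otimes>\<^bsub>X\<^esub> inv\<^bsub>X\<^esub> (s (q x)) = y \<otimes>\<^bsub>X\<^esub> inv\<^bsub>X\<^esub> (s (q y))"
      by (rule inv_into_injective) (use mem x y in blast)+
    then show "x = y" using x y sq[OF y] by (simp add: qxy)
  qed
  define \<psi> where "\<psi> = inv_into (carrier X) \<phi>"
  have \<psi>\<phi>: "\<psi> (\<phi> x) = x" if "x \<in> carrier X" for x
    using that inj\<phi> by (simp add: \<psi>_def)
  define Y where "Y = with_topology
     \<lparr>carrier = \<phi> ` carrier X, monoid.mult = (\<lambda>a b. \<phi> (\<psi> a \<otimes>\<^bsub>X\<^esub> \<psi> b)), one = \<phi> \<one>\<^bsub>X\<^esub>\<rparr>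
     (quotient_topology (topo X) \<phi>)"
  have Ysimps: "carrier Y = \<phi> ` carrier X" "one Y = \<phi> \<one>\<^bsub>X\<^esub>"
    "topo Y = quotient_topology (topo X) \<phi>"
    "monoid.mult Y = (\<lambda>a b. \<phi> (\<psi> a \<otimes>\<^bsub>X\<^esub> \<psi> b))"
    by (simp_all add: Y_def)
  have hm: "homeomorphic_map (topo X) (topo Y) \<phi>"
    unfolding homeomorphic_map_def
    using quotient_map_quotient_topology inj\<phi> by (simp add: X.topspace_topo Ysimps)
  have \<phi>c: "continuous_map (topo X) (topo Y) \<phi>"
    by (rule homeomorphic_imp_continuous_map[OF hm])
  have tY: "topspace (topo Y) = carrier Y"
    using homeomorphic_imp_surjective_map[OF hm] by (simp add: X.topspace_topo Ysimps)
  obtain \<psi>' where maps: "homeomorphic_maps (topo X) (topo Y) \<phi> \<psi>'"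
    using hm homeomorphic_map_maps by blast
  have "continuous_map (topo Y) (topo X) \<psi>'"
    using maps by (simp add: homeomorphic_maps_def)
  moreover have \<psi>eq: "\<psi>' y = \<psi> y" if "y \<in> topspace (topo Y)" for y
  proof -
    from that obtain x where x: "x \<in> carrier X" "y = \<phi> x"
      unfolding tY unfolding Ysimps by blast
    then have "\<psi>' y = x"
      using maps by (simp add: homeomorphic_maps_def X.topspace_topo)
    then show ?thesis using x \<psi>\<phi> by simp
  qed
  ultimately have \<psi>c: "continuous_map (topo Y) (topo X) \<psi>"
    by (rule continuous_map_eq)
  have \<phi>h: "\<phi> \<in> iso X Y"
    using inj\<phi> \<psi>\<phi> by (auto simp: iso_def hom_def bij_betw_def Ysimps)
  have "comm_group (Y\<lparr>one := \<phi> \<one>\<^bsub>X\<^esub>\<rparr>)"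
    by (rule X.iso_imp_img_comm_group[OF \<phi>h])
  then have cY: "comm_group Y"
    by (simp add: Y_def with_topology_def monoid.defs topgroup.defs)
  interpret Y: comm_group Y by (rule cY)
  interpret \<phi>: group_hom X Y \<phi>
    by unfold_locales (use \<phi>h in \<open>simp add: iso_def\<close>)
  have \<psi>in: "\<psi> y \<in> carrier X" "\<phi> (\<psi> y) = y" if "y \<in> carrier Y" for y
    using that \<psi>\<phi> by (auto simp: Ysimps)
  have Y: "topological_ab_group Y"
  proof (unfold_locales)
    show "topspace (topo Y) = carrier Y" by (rule tY)
    show "Hausdorff_space (topo Y)"
      using X.Hausdorff_topo hm homeomorphic_Hausdorff_space homeomorphic_map_imp_homeomorphic_space
      by blast
    have "continuous_map (prod_topology (topo Y) (topo Y)) (prod_topology (topo X) (topo X))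
            (\<lambda>z. (\<psi> (fst z), \<psi> (snd z)))"
      by (intro continuous_map_pairedI continuous_map_compose[OF continuous_map_fst \<psi>c, unfolded o_def]
          continuous_map_compose[OF continuous_map_snd \<psi>c, unfolded o_def])
    from continuous_map_compose[OF continuous_map_compose[OF this X.continuous_mult] \<phi>c]
    show "continuous_map (prod_topology (topo Y) (topo Y)) (topo Y) (\<lambda>(x, y). x \<otimes>\<^bsub>Y\<^esub> y)"
      by (rule continuous_map_eq) (auto simp: Ysimps)
    from continuous_map_compose[OF continuous_map_compose[OF \<psi>c X.continuous_inv] \<phi>c]
    show "continuous_map (topo Y) (topo Y) (m_inv Y)"
      by (rule continuous_map_eq) (auto simp: tY \<psi>in)
  qed
  define E' where "E' = \<lparr>total = Y, incl = \<phi> \<circ> i, proj = q \<circ> \<psi>\<rparr>"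
  have \<psi>h: "\<psi> \<in> hom Y X"
  proof (rule homI)
    fix a b assume ab: "a \<in> carrier Y" "b \<in> carrier Y"
    show "\<psi> a \<in> carrier X" by (rule \<psi>in(1)[OF ab(1)])
    show "\<psi> (a \<otimes>\<^bsub>Y\<^esub> b) = \<psi> a \<otimes>\<^bsub>X\<^esub> \<psi> b"
      unfolding Ysimps(4) by (intro \<psi>\<phi> X.m_closed \<psi>in(1) ab)
  qed
  have im\<psi>: "\<psi> ` carrier Y = carrier X"
    unfolding Ysimps(1) image_image by (simp cong: image_cong_simp add: \<psi>\<phi>)
  have iX: "i h \<in> carrier X" if "h \<in> carrier H" for h
    using ih that by (auto simp: hom_def)
  have "is_extension G H E'"
    unfolding is_extension_def E'_def extension.simps
  proof (intro conjI G H Y)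
    show "\<phi> \<circ> i \<in> top_hom H Y"
      using ih \<phi>.homh ic \<phi>c by (simp add: top_hom_def hom_compose continuous_map_compose)
    show "q \<circ> \<psi> \<in> top_hom Y G"
      using \<psi>h qh \<psi>c qc by (simp add: top_hom_def hom_compose continuous_map_compose)
    show "inj_on (\<phi> \<circ> i) (carrier H)"
      using inj inj\<phi> iX by (auto simp: inj_on_def)
    show "(q \<circ> \<psi>) ` carrier Y = carrier G"
      unfolding image_comp[symmetric] im\<psi> by (rule surj)
    show "(\<phi> \<circ> i) ` carrier H = kernel Y G (q \<circ> \<psi>)"
    proof -
      have "kernel Y G (q \<circ> \<psi>) = \<phi> ` kernel X G q"
        unfolding kernel_def Ysimps(1) o_def
        by (safe; simp add: \<psi>\<phi>; blast?)
      then show ?thesis by (simp add: image_comp flip: ker)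
    qed
    have homeo: "homeomorphic_map (subtopology (topo X) (i ` carrier H))
        (subtopology (topo Y) (\<phi> ` (i ` carrier H))) \<phi>"
      by (rule homeomorphic_map_subtopologies_alt[OF hm])
        (use iX inj\<phi> in \<open>auto simp: X.topspace_topo inj_on_def\<close>)
    show "open_onto_image H Y (\<phi> \<circ> i)"
      using open_map_compose[OF io[unfolded open_onto_image_def] homeomorphic_imp_open_map[OF homeo]]
      by (simp add: open_onto_image_def image_comp)
    have "homeomorphic_map (topo Y) (topo X) \<psi>"
      using maps \<psi>eq homeomorphic_map_eq unfolding homeomorphic_maps_map by blast
    then have "open_map (topo Y) (topo X) \<psi>" by (rule homeomorphic_imp_open_map)
    moreover have "(q \<circ> \<psi>) ` carrier Y = q ` carrier X"
      unfolding image_comp[symmetric] im\<psi> by (rule refl)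
    ultimately show "open_onto_image Y G (q \<circ> \<psi>)"
      using qo open_map_compose by (auto simp: open_onto_image_def)
  qed
  moreover have "\<phi> \<in> top_hom X Y"
    using \<phi>.homh \<phi>c by (simp add: top_hom_def)
  ultimately have "ext_equiv G H E E'"
    using E \<psi>\<phi> unfolding ext_equiv_def
    by (auto simp: E'_def X_def[symmetric] i_def[symmetric] q_def[symmetric] intro!: bexI[of _ \<phi>])
  then show ?thesis by (auto simp: ext_class_def)
qed

definition trivial_ext :: "'g topgroup \<Rightarrow> 'h topgroup \<Rightarrow> ('h, 'h \<times> 'g, 'g) extension" where
  "trivial_ext G H =
     \<lparr>total = top_DirProd H G, incl = (\<lambda>h. (h, \<one>\<^bsub>G\<^esub>)), proj = snd\<rparr>"

definition product_ext ::
  "('h1, 'x1, 'g1) extension \<Rightarrow> ('h2, 'x2, 'g2) extension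
     \<Rightarrow> ('h1 \<times> 'h2, 'x1 \<times> 'x2, 'g1 \<times> 'g2) extension" where
  "product_ext E1 E2 =
     \<lparr>total = top_DirProd (total E1) (total E2),
      incl = map_prod (incl E1) (incl E2),
      proj = map_prod (proj E1) (proj E2)\<rparr>"

text \<open>Pull-back along \<open>f : G' \<rightarrow> G\<close>.\<close>

definition pullback_ext ::
  "'g2 topgroup \<Rightarrow> ('g2 \<Rightarrow> 'g) \<Rightarrow> ('h, 'x, 'g) extension \<Rightarrow> ('h, 'x \<times> 'g2, 'g2) extension" where
  "pullback_ext G' f E =
     \<lparr>total = top_subgroup (top_DirProd (total E) G')
        {(x, g). x \<in> carrier (total E) \<and> g \<in> carrier G' \<and> proj E x = f g},
      incl = (\<lambda>h. (incl E h, \<one>\<^bsub>G'\<^esub>)),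
      proj = snd\<rparr>"

text \<open>Push-out along \<open>f : H \<rightarrow> H'\<close>: the quotient of \<open>X \<times> H'\<close> by the subgroup of all
  \<open>(\<i> h, - f h)\<close>. This subgroup is closed, being the graph of a continuous function on the closed
  subgroup \<open>\<i> H\<close>, so the quotient is Hausdorff and is the push-out of Hausdorff groups.\<close>

definition pushout_kernel ::
  "'h topgroup \<Rightarrow> 'h2 topgroup \<Rightarrow> ('h \<Rightarrow> 'h2) \<Rightarrow> ('h, 'x, 'g) extension \<Rightarrow> ('x \<times> 'h2) set" where
  "pushout_kernel H H' f E = (\<lambda>h. (incl E h, inv\<^bsub>H'\<^esub> (f h))) ` carrier H"

definition pushout_ext ::
  "'h topgroup \<Rightarrow> 'h2 topgroup \<Rightarrow> ('h \<Rightarrow> 'h2) \<Rightarrow> ('h, 'x, 'g) extension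
     \<Rightarrow> ('h2, ('x \<times> 'h2) set, 'g) extension" where
  "pushout_ext H H' f E =
     (let P = top_DirProd (total E) H'; N = pushout_kernel H H' f E in
      \<lparr>total = top_quotient_group P N,
       incl = (\<lambda>h'. N #>\<^bsub>P\<^esub> (\<one>\<^bsub>total E\<^esub>, h')),
       proj = (\<lambda>A. the_elem ((\<lambda>(x, h'). proj E x) ` A))\<rparr>)"

definition baer_sum ::
  "'g topgroup \<Rightarrow> 'h topgroup \<Rightarrow> ('h, 'x, 'g) extension \<Rightarrow> ('h, 'y, 'g) extension
     \<Rightarrow> ('h, ((('x \<times> 'y) \<times> 'g) \<times> 'h) set, 'g) extension" where
  "baer_sum G H E1 E2 =
     pushout_ext (top_DirProd H H) H (\<lambda>(a, b). a \<otimes>\<^bsub>H\<^esub> b)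
       (pullback_ext G (\<lambda>g. (g, g)) (product_ext E1 E2))"

definition Ext :: "'g topgroup \<Rightarrow> 'h topgroup \<Rightarrow> ('h, 'h \<times> 'g, 'g) extension set monoid" where
  "Ext G H =
     \<lparr>carrier = ext_class G H ` {E :: ('h, 'h \<times> 'g, 'g) extension. is_extension G H E},
      monoid.mult = (\<lambda>A B. \<Union>E1\<in>A. \<Union>E2\<in>B. ext_class G H (baer_sum G H E1 E2)),
      one = ext_class G H (trivial_ext G H)\<rparr>"

definition divisible :: "('a, 'm) monoid_scheme \<Rightarrow> bool" where
  "divisible A \<longleftrightarrow>
     (\<forall>x \<in> carrier A. \<forall>n::nat. n > 0 \<longrightarrow> (\<exists>y \<in> carrier A. y [^]\<^bsub>A\<^esub> n = x))"

definition torsion_free :: "('a, 'm) monoid_scheme \<Rightarrow> bool" where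
  "torsion_free A \<longleftrightarrow>
     (\<forall>x \<in> carrier A. \<forall>n::nat. n > 0 \<longrightarrow> x [^]\<^bsub>A\<^esub> n = \<one>\<^bsub>A\<^esub> \<longrightarrow> x = \<one>\<^bsub>A\<^esub>)"


section \<open>The additive group of p-adic numbers\<close>

text \<open>Cauchy sequences of rationals for the p-adic absolute value modulo null sequences.\<close>

definition padic_abs :: "nat \<Rightarrow> rat \<Rightarrow> real" where
  "padic_abs p x =
     (if x = 0 then 0
      else real p powi (int (multiplicity (int p) (snd (quotient_of x)))
                        - int (multiplicity (int p) (fst (quotient_of x)))))"

definition padic_cauchy_group :: "nat \<Rightarrow> (nat \<Rightarrow> rat) monoid" where
  "padic_cauchy_group p =
     \<lparr>carrier = {s. Metric_space.MCauchy UNIV (\<lambda>x y. padic_abs p (x - y)) s},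
      monoid.mult = (\<lambda>s t n. s n + t n),
      one = (\<lambda>n. 0)\<rparr>"

definition padic_null :: "nat \<Rightarrow> (nat \<Rightarrow> rat) set" where
  "padic_null p = {s. (\<lambda>n. padic_abs p (s n)) \<longlonglongrightarrow> 0}"

definition padic_group :: "nat \<Rightarrow> (nat \<Rightarrow> rat) set monoid" where
  "padic_group p = padic_cauchy_group p Mod padic_null p"

text \<open>The value 0 off the carrier is there because the locale \<open>Metric_space\<close> demands symmetry and
  non-negativity on the whole type.\<close>

definition padic_dist :: "nat \<Rightarrow> (nat \<Rightarrow> rat) set \<Rightarrow> (nat \<Rightarrow> rat) set \<Rightarrow> real" where
  "padic_dist p A B =
     (if A \<in> carrier (padic_group p) \<and> B \<in> carrier (padic_group p)
      then THE d. \<exists>s\<in>A. \<exists>t\<in>B. (\<lambda>n. padic_abs p (s n - t n)) \<longlonglongrightarrow> d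
      else 0)"

definition Qp :: "nat \<Rightarrow> (nat \<Rightarrow> rat) set topgroup" where
  "Qp p = with_topology (padic_group p)
     (Metric_space.mtopology (carrier (padic_group p)) (padic_dist p))"

text \<open>An ordinal is given, as usual in HOL, by a well-order \<open>r\<close>; the index set is \<open>Field r\<close>.\<close>

definition padic_product :: "(nat \<Rightarrow> 'i rel) \<Rightarrow> (nat \<Rightarrow> 'i \<Rightarrow> (nat \<Rightarrow> rat) set) topgroup" where
  "padic_product \<alpha> =
     top_product_group {p. prime p} (\<lambda>p. top_product_group (Field (\<alpha> p)) (\<lambda>_. Qp p))"

end

theory Submission
  imports Defs
begin

text \<open>
  Write \<open>H\<close> for the product of the groups \<open>\<rat>\<^sub>p\<^bsup>\<alpha>\<^esup>\<close>; groups are written additively in all comments.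
  For every \<open>n > 0\<close>, multiplication by \<open>n\<close> is a topological automorphism of \<open>H\<close>: on \<open>\<rat>\<^sub>p\<close> it multiplies
  distances by a positive constant, and division by \<open>n\<close> on the product acts componentwise
  (\<open>continuously_divisible_Qp\<close>, \<open>continuously_divisible_product\<close>). The group of extensions is a functor
  of the kernel by means of push-outs, and multiplication by \<open>n\<close> on it is induced by multiplication by
  \<open>n\<close> on \<open>H\<close> (\<open>Ext_nat_pow\<close>). Thus it is bijective, which means that the group of extensions is
  divisible and torsion-free (\<open>divisible_Ext\<close>, \<open>torsion_free_Ext\<close>).

  Quotients of topological groups are avoided in all computations with Baer sums by working with
  morphisms of extensions that are the identity on \<open>G\<close> and a given homomorphism \<open>f\<close> on the kernels.
  The one topological argument is \<open>ext_morphism_determines_target\<close>: two extensions that receive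
  morphisms from the same extension over the same \<open>f\<close> are equivalent. Together with the existence of
  push-outs (\<open>pushout_ext_properties\<close>) and the fact that morphisms \<open>E \<rightarrow> E\<^sub>1\<close> over \<open>f\<^sub>1\<close> and \<open>E \<rightarrow> E\<^sub>2\<close>
  over \<open>f\<^sub>2\<close> yield a morphism from \<open>E\<close> to the Baer sum over \<open>f\<^sub>1 + f\<^sub>2\<close> (\<open>ext_morphism_baer_sum\<close>), it
  reduces the group laws and the statements on multiplication by \<open>n\<close> to identities between maps on
  the kernels.
\<close>

section \<open>Topological abelian groups\<close>

lemma comm_group_cong:
  assumes "comm_group A" "carrier B = carrier A" "monoid.mult B = monoid.mult A" "one B = one A"
  shows "comm_group B"
proof -
  interpret A: comm_group A by (rule assms(1))
  show ?thesis
  proof (rule comm_groupI, unfold assms(2-4))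
    fix x assume "x \<in> carrier A"
    then show "\<exists>y\<in>carrier A. y \<otimes>\<^bsub>A\<^esub> x = \<one>\<^bsub>A\<^esub>"
      by (intro bexI[of _ "inv\<^bsub>A\<^esub> x"]) auto
  qed (auto simp: A.m_assoc intro: A.m_comm)
qed

lemma m_inv_cong:
  assumes "carrier B = carrier A" "monoid.mult B = monoid.mult A" "one B = one A"
  shows "m_inv B = m_inv A"
  by (simp add: m_inv_def assms fun_eq_iff)

lemma openin_prod_box:
  assumes "openin (prod_topology X Y) S" "(x, y) \<in> S"
  obtains U V where "openin X U" "openin Y V" "x \<in> U" "y \<in> V" "U \<times> V \<subseteq> S"
  using assms(1)[unfolded openin_prod_topology_alt, rule_format, OF assms(2)]
  by (elim exE conjE)

context topological_ab_group
begin

lemma openin_carrier: "openin (topo G) U \<Longrightarrow> x \<in> U \<Longrightarrow> x \<in> carrier G"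
  using openin_subset topspace_topo by blast

lemma continuous_map_mult:
  assumes "continuous_map T (topo G) f" "continuous_map T (topo G) g"
  shows "continuous_map T (topo G) (\<lambda>x. f x \<otimes> g x)"
  using continuous_map_compose[OF continuous_map_pairedI[OF assms] continuous_mult]
  by (simp add: o_def)

lemma continuous_map_inv:
  assumes "continuous_map T (topo G) f"
  shows "continuous_map T (topo G) (\<lambda>x. inv (f x))"
  using continuous_map_compose[OF assms continuous_inv] by (simp add: o_def)

lemma continuous_map_translate: "a \<in> carrier G \<Longrightarrow> continuous_map (topo G) (topo G) (\<lambda>x. a \<otimes> x)"
  by (rule continuous_map_mult) (auto simp: topspace_topo)

lemma openin_translate:
  assumes "openin (topo G) U" "a \<in> carrier G"
  shows "openin (topo G) {x \<in> carrier G. a \<otimes> x \<in> U}"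
  using openin_continuous_map_preimage[OF continuous_map_translate[OF assms(2)] assms(1)]
  by (simp add: topspace_topo)

lemma nbhd_of_binary_op:
  assumes c: "continuous_map (prod_topology (topo G) (topo G)) (topo G) (\<lambda>z. c (fst z) (snd z))"
    and U: "openin (topo G) U" "c a b \<in> U" and ab: "a \<in> carrier G" "b \<in> carrier G"
  obtains V W where "openin (topo G) V" "a \<in> V" "openin (topo G) W" "b \<in> W"
    "\<forall>x\<in>V. \<forall>y\<in>W. c x y \<in> U"
proof -
  let ?S = "{z \<in> topspace (prod_topology (topo G) (topo G)). c (fst z) (snd z) \<in> U}"
  have "openin (prod_topology (topo G) (topo G)) ?S" "(a, b) \<in> ?S"
    using openin_continuous_map_preimage[OF c U(1)] U(2) ab by (simp_all add: topspace_topo)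
  then obtain V W where "openin (topo G) V" "openin (topo G) W" "a \<in> V" "b \<in> W"
    "V \<times> W \<subseteq> ?S"
    by (rule openin_prod_box)
  then show thesis by (intro that[of V W]) (simp_all add: subset_iff)
qed

lemma continuous_map_mult_pair:
  "continuous_map (prod_topology (topo G) (topo G)) (topo G) (\<lambda>z. fst z \<otimes> snd z)"
  by (intro continuous_map_mult continuous_map_fst continuous_map_snd)

lemma continuous_map_div_pair:
  "continuous_map (prod_topology (topo G) (topo G)) (topo G) (\<lambda>z. fst z \<otimes> inv (snd z))"
  by (intro continuous_map_mult continuous_map_inv continuous_map_fst continuous_map_snd)

lemma one_nbhd_mult:
  assumes "openin (topo G) U" "\<one> \<in> U"
  obtains V where "openin (topo G) V" "\<one> \<in> V" "\<forall>x\<in>V. \<forall>y\<in>V. x \<otimes> y \<in> U"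
proof -
  obtain V W where "openin (topo G) V" "\<one> \<in> V" "openin (topo G) W" "\<one> \<in> W"
    "\<forall>x\<in>V. \<forall>y\<in>W. x \<otimes> y \<in> U"
    by (rule nbhd_of_binary_op[OF continuous_map_mult_pair assms(1), of \<one> \<one>]) (use assms in auto)
  then show thesis by (intro that[of "V \<inter> W"]) auto
qed

lemma one_nbhd_div:
  assumes "openin (topo G) U" "\<one> \<in> U"
  obtains V where "openin (topo G) V" "\<one> \<in> V" "\<forall>x\<in>V. \<forall>y\<in>V. x \<otimes> inv y \<in> U"
proof -
  obtain V W where "openin (topo G) V" "\<one> \<in> V" "openin (topo G) W" "\<one> \<in> W"
    "\<forall>x\<in>V. \<forall>y\<in>W. x \<otimes> inv y \<in> U"
    by (rule nbhd_of_binary_op[OF continuous_map_div_pair assms(1), of \<one> \<one>]) (use assms in auto)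
  then show thesis by (intro that[of "V \<inter> W"]) auto
qed

end

lemma topological_ab_groupI:
  assumes "comm_group G" "topspace (topo G) = carrier G" "Hausdorff_space (topo G)"
    "continuous_map (prod_topology (topo G) (topo G)) (topo G) (\<lambda>z. fst z \<otimes>\<^bsub>G\<^esub> snd z)"
    "continuous_map (topo G) (topo G) (m_inv G)"
  shows "topological_ab_group G"
  using assms
  by (simp add: topological_ab_group_def topological_ab_group_axioms_def case_prod_unfold)

text \<open>Translations are homeomorphisms, so continuity and openness of a homomorphism have to be
  tested on neighbourhoods of the identity only.\<close>

lemma hom_continuous_at_one:
  assumes G: "topological_ab_group G" and H: "topological_ab_group H" and f: "f \<in> hom G H"
    and one: "\<And>U. openin (topo H) U \<Longrightarrow> \<one>\<^bsub>H\<^esub> \<in> U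
      \<Longrightarrow> \<exists>V. openin (topo G) V \<and> \<one>\<^bsub>G\<^esub> \<in> V \<and> f ` V \<subseteq> U"
  shows "continuous_map (topo G) (topo H) f"
proof -
  interpret G: topological_ab_group G by (rule G)
  interpret H: topological_ab_group H by (rule H)
  interpret f: group_hom G H f by unfold_locales (rule f)
  have "openin (topo G) {x \<in> carrier G. f x \<in> U}" if U: "openin (topo H) U" for U
  proof (subst openin_subopen, intro ballI)
    fix x assume x: "x \<in> {x \<in> carrier G. f x \<in> U}"
    then have "\<one>\<^bsub>H\<^esub> \<in> {z \<in> carrier H. f x \<otimes>\<^bsub>H\<^esub> z \<in> U}" by simp
    from one[OF H.openin_translate[OF U] this] x
    obtain V where V: "openin (topo G) V" "\<one>\<^bsub>G\<^esub> \<in> V"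
      "f ` V \<subseteq> {z \<in> carrier H. f x \<otimes>\<^bsub>H\<^esub> z \<in> U}"
      by auto
    have "f y \<in> U" if y: "y \<in> carrier G" "inv\<^bsub>G\<^esub> x \<otimes>\<^bsub>G\<^esub> y \<in> V" for y
    proof -
      have "f x \<otimes>\<^bsub>H\<^esub> f (inv\<^bsub>G\<^esub> x \<otimes>\<^bsub>G\<^esub> y) \<in> U" using V(3) y by auto
      moreover have "f x \<otimes>\<^bsub>H\<^esub> f (inv\<^bsub>G\<^esub> x \<otimes>\<^bsub>G\<^esub> y) = f y"
        using x y(1) by (simp add: H.m_assoc[symmetric])
      ultimately show ?thesis by simp
    qed
    then show "\<exists>T. openin (topo G) T \<and> x \<in> T \<and> T \<subseteq> {x \<in> carrier G. f x \<in> U}"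
      using G.openin_translate[OF V(1), of "inv\<^bsub>G\<^esub> x"] x V(2)
      by (intro exI[of _ "{y \<in> carrier G. inv\<^bsub>G\<^esub> x \<otimes>\<^bsub>G\<^esub> y \<in> V}"]) auto
  qed
  then show ?thesis by (auto simp: continuous_map_def G.topspace_topo H.topspace_topo)
qed

lemma open_onto_image_at_one:
  assumes G: "topological_ab_group G" and H: "topological_ab_group H" and f: "f \<in> hom G H"
    and one: "\<And>U. openin (topo G) U \<Longrightarrow> \<one>\<^bsub>G\<^esub> \<in> U
      \<Longrightarrow> \<exists>W. openin (topo H) W \<and> \<one>\<^bsub>H\<^esub> \<in> W \<and> W \<inter> f ` carrier G \<subseteq> f ` U"
  shows "open_onto_image G H f"
proof -
  interpret G: topological_ab_group G by (rule G)
  interpret H: topological_ab_group H by (rule H)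
  interpret f: group_hom G H f by unfold_locales (rule f)
  have "openin (subtopology (topo H) (f ` carrier G)) (f ` U)" if U: "openin (topo G) U" for U
  proof (subst openin_subopen, intro ballI)
    fix y assume "y \<in> f ` U"
    then obtain u where u: "u \<in> U" "y = f u" by blast
    have uG: "u \<in> carrier G" using G.openin_carrier[OF U] u by blast
    then have "\<one>\<^bsub>G\<^esub> \<in> {z \<in> carrier G. u \<otimes>\<^bsub>G\<^esub> z \<in> U}" using u by simp
    from one[OF G.openin_translate[OF U uG] this]
    obtain W where W: "openin (topo H) W" "\<one>\<^bsub>H\<^esub> \<in> W"
      "W \<inter> f ` carrier G \<subseteq> f ` {z \<in> carrier G. u \<otimes>\<^bsub>G\<^esub> z \<in> U}"
      by (elim exE conjE)
    let ?T = "{w \<in> carrier H. inv\<^bsub>H\<^esub> f u \<otimes>\<^bsub>H\<^esub> w \<in> W}"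
    have "openin (topo H) ?T" using H.openin_translate[OF W(1), of "inv\<^bsub>H\<^esub> f u"] uG by simp
    moreover have "y \<in> ?T" using u uG W(2) by simp
    moreover have "f z \<in> f ` U" if z: "z \<in> carrier G" "f z \<in> ?T" for z
    proof -
      have "f (inv\<^bsub>G\<^esub> u \<otimes>\<^bsub>G\<^esub> z) \<in> W" using z uG by simp
      then obtain z' where z': "z' \<in> carrier G" "u \<otimes>\<^bsub>G\<^esub> z' \<in> U" "f (inv\<^bsub>G\<^esub> u \<otimes>\<^bsub>G\<^esub> z) = f z'"
        using W(3) z(1) uG by blast
      have "f (u \<otimes>\<^bsub>G\<^esub> z') = f u \<otimes>\<^bsub>H\<^esub> f (inv\<^bsub>G\<^esub> u \<otimes>\<^bsub>G\<^esub> z)" using uG z' by simp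
      also have "\<dots> = f z" using uG z(1) by (simp add: H.m_assoc[symmetric])
      finally show ?thesis using z'(2) by (metis imageI)
    qed
    ultimately show "\<exists>T. openin (subtopology (topo H) (f ` carrier G)) T \<and> y \<in> T \<and> T \<subseteq> f ` U"
      using u uG by (intro exI[of _ "?T \<inter> f ` carrier G"])
        (auto simp: openin_subtopology_Int)
  qed
  then show ?thesis by (simp add: open_onto_image_def open_map_def)
qed

section \<open>Products, subgroups and quotients\<close>

lemma top_DirProd_simps [simp]:
  "carrier (top_DirProd G H) = carrier G \<times> carrier H"
  "monoid.mult (top_DirProd G H) = (\<lambda>(g, h) (g', h'). (g \<otimes>\<^bsub>G\<^esub> g', h \<otimes>\<^bsub>H\<^esub> h'))"
  "one (top_DirProd G H) = (\<one>\<^bsub>G\<^esub>, \<one>\<^bsub>H\<^esub>)"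
  "topo (top_DirProd G H) = prod_topology (topo G) (topo H)"
  by (simp_all add: top_DirProd_def DirProd_def)

lemma inv_top_DirProd [simp]:
  assumes "group G" "group H" "g \<in> carrier G" "h \<in> carrier H"
  shows "inv\<^bsub>top_DirProd G H\<^esub> (g, h) = (inv\<^bsub>G\<^esub> g, inv\<^bsub>H\<^esub> h)"
  using inv_DirProd[OF assms] m_inv_cong[of "top_DirProd G H" "G \<times>\<times> H"]
  by (simp add: DirProd_def)

lemma topological_ab_group_DirProd:
  assumes G: "topological_ab_group G" and H: "topological_ab_group H"
  shows "topological_ab_group (top_DirProd G H)"
proof -
  interpret G: topological_ab_group G by (rule G)
  interpret H: topological_ab_group H by (rule H)
  have comm: "comm_group (top_DirProd G H)"
  proof (rule comm_groupI)
    fix x assume "x \<in> carrier (top_DirProd G H)"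
    then show "\<exists>y\<in>carrier (top_DirProd G H). y \<otimes>\<^bsub>top_DirProd G H\<^esub> x = \<one>\<^bsub>top_DirProd G H\<^esub>"
      by (intro bexI[of _ "(inv\<^bsub>G\<^esub> fst x, inv\<^bsub>H\<^esub> snd x)"]) auto
  qed (auto simp: G.m_assoc H.m_assoc intro: G.m_comm H.m_comm)
  let ?D = "prod_topology (topo G) (topo H)"
  note components = continuous_map_compose[OF continuous_map_fst[of ?D ?D] continuous_map_fst]
    continuous_map_compose[OF continuous_map_snd[of ?D ?D] continuous_map_fst]
    continuous_map_compose[OF continuous_map_fst[of ?D ?D] continuous_map_snd]
    continuous_map_compose[OF continuous_map_snd[of ?D ?D] continuous_map_snd]
  show ?thesis
  proof (rule topological_ab_groupI[OF comm])
    have "continuous_map (prod_topology (topo G) (topo H)) (prod_topology (topo G) (topo H))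
        (\<lambda>z. (inv\<^bsub>G\<^esub> fst z, inv\<^bsub>H\<^esub> snd z))"
      by (intro continuous_map_pairedI G.continuous_map_inv H.continuous_map_inv
          continuous_map_fst continuous_map_snd)
    then show "continuous_map (topo (top_DirProd G H)) (topo (top_DirProd G H)) (m_inv (top_DirProd G H))"
      unfolding top_DirProd_simps(4)
      by (rule continuous_map_eq) (auto simp: G.topspace_topo H.topspace_topo)
    have "continuous_map (prod_topology (topo (top_DirProd G H)) (topo (top_DirProd G H)))
       (topo (top_DirProd G H)) (\<lambda>z. (fst (fst z) \<otimes>\<^bsub>G\<^esub> fst (snd z), snd (fst z) \<otimes>\<^bsub>H\<^esub> snd (snd z)))"
      unfolding top_DirProd_simps(4)
      by (intro continuous_map_pairedI G.continuous_map_mult H.continuous_map_mult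
          components[unfolded o_def])
    then show "continuous_map (prod_topology (topo (top_DirProd G H)) (topo (top_DirProd G H)))
       (topo (top_DirProd G H)) (\<lambda>z. fst z \<otimes>\<^bsub>top_DirProd G H\<^esub> snd z)"
      by (simp add: case_prod_unfold)
  qed (simp_all add: G.topspace_topo H.topspace_topo G.Hausdorff_topo H.Hausdorff_topo Hausdorff_space_prod_topology)
qed

lemma top_subgroup_simps [simp]:
  "carrier (top_subgroup G S) = S"
  "monoid.mult (top_subgroup G S) = monoid.mult G"
  "one (top_subgroup G S) = one G"
  "topo (top_subgroup G S) = subtopology (topo G) S"
  by (simp_all add: top_subgroup_def)

lemma topological_ab_group_subgroup:
  assumes G: "topological_ab_group G" and S: "subgroup S G"
  shows "topological_ab_group (top_subgroup G S)"
proof -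
  interpret G: topological_ab_group G by (rule G)
  have SG: "S \<subseteq> carrier G" using S by (rule subgroup.subset)
  have cS: "comm_group (G\<lparr>carrier := S\<rparr>)"
    by (rule group.group_comm_groupI[OF subgroup.subgroup_is_group[OF S G.group_axioms]])
      (use SG in \<open>auto intro: G.m_comm\<close>)
  then have comm: "comm_group (top_subgroup G S)"
    by (rule comm_group_cong) auto
  have inv: "inv\<^bsub>top_subgroup G S\<^esub> x = inv\<^bsub>G\<^esub> x" if "x \<in> S" for x
    using G.m_inv_consistent[OF S that] m_inv_cong[of "top_subgroup G S" "G\<lparr>carrier := S\<rparr>"] by simp
  show ?thesis
  proof (rule topological_ab_groupI[OF comm])
    show "topspace (topo (top_subgroup G S)) = carrier (top_subgroup G S)"
      using SG by (auto simp: G.topspace_topo)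
    show "Hausdorff_space (topo (top_subgroup G S))"
      by (simp add: Hausdorff_space_subtopology G.Hausdorff_topo)
    have "continuous_map (subtopology (topo G) S) (subtopology (topo G) S) (m_inv G)"
      using subgroup.m_inv_closed[OF S]
      by (auto simp: continuous_map_in_subtopology continuous_map_from_subtopology G.continuous_inv)
    then show "continuous_map (topo (top_subgroup G S)) (topo (top_subgroup G S)) (m_inv (top_subgroup G S))"
      unfolding top_subgroup_simps by (rule continuous_map_eq) (simp add: inv)
    show "continuous_map (prod_topology (topo (top_subgroup G S)) (topo (top_subgroup G S)))
       (topo (top_subgroup G S)) (\<lambda>z. fst z \<otimes>\<^bsub>top_subgroup G S\<^esub> snd z)"
      unfolding top_subgroup_simps
      using G.continuous_map_mult_pair subgroup.m_closed[OF S]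
      by (auto simp: continuous_map_in_subtopology prod_topology_subtopology continuous_map_from_subtopology)
  qed
qed

lemma top_product_group_simps [simp]:
  "carrier (top_product_group I G) = (\<Pi>\<^sub>E i\<in>I. carrier (G i))"
  "monoid.mult (top_product_group I G) = (\<lambda>x y. \<lambda>i\<in>I. x i \<otimes>\<^bsub>G i\<^esub> y i)"
  "one (top_product_group I G) = (\<lambda>i\<in>I. \<one>\<^bsub>G i\<^esub>)"
  "topo (top_product_group I G) = product_topology (\<lambda>i. topo (G i)) I"
  by (simp_all add: top_product_group_def)

lemma topological_ab_group_product:
  assumes G: "\<And>i. i \<in> I \<Longrightarrow> topological_ab_group (G i)"
  shows "topological_ab_group (top_product_group I G)"
proof (rule topological_ab_groupI)
  have grp: "group (G i)" and comm: "comm_monoid (G i)" and top: "topspace (topo (G i)) = carrier (G i)"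
    if "i \<in> I" for i
    using G[OF that] by (simp_all add: topological_ab_group_def comm_group_def topological_ab_group_axioms_def)
  show topspace: "topspace (topo (top_product_group I G)) = carrier (top_product_group I G)"
    by (auto simp: top cong: PiE_cong)
  have "comm_group (product_group I G)"
    using comm_monoid.m_comm[OF comm]
    by (intro group.group_comm_groupI product_group grp) (auto simp: PiE_iff intro!: restrict_ext)
  then show "comm_group (top_product_group I G)"
    by (rule comm_group_cong) auto
  show "Hausdorff_space (topo (top_product_group I G))"
    using G by (auto simp: Hausdorff_space_product_topology topological_ab_group.Hausdorff_topo)
  let ?T = "product_topology (\<lambda>i. topo (G i)) I"
  have component: "continuous_map ?T (topo (G i)) (\<lambda>x. x i)" if "i \<in> I" for i
    by (rule continuous_map_product_projection[OF that])
  have "continuous_map ?T ?T (\<lambda>x. \<lambda>i\<in>I. inv\<^bsub>G i\<^esub> x i)"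
    using component G by (auto simp: continuous_map_componentwise topological_ab_group.continuous_map_inv)
  then show "continuous_map (topo (top_product_group I G)) (topo (top_product_group I G))
      (m_inv (top_product_group I G))"
    unfolding top_product_group_simps
  proof (rule continuous_map_eq)
    fix x assume "x \<in> topspace ?T"
    then have "x \<in> (\<Pi>\<^sub>E i\<in>I. carrier (G i))" using topspace by simp
    then show "(\<lambda>i\<in>I. inv\<^bsub>G i\<^esub> x i) = inv\<^bsub>top_product_group I G\<^esub> x"
      using grp m_inv_cong[of "top_product_group I G" "product_group I G"] by simp
  qed
  have "continuous_map (prod_topology ?T ?T) (topo (G i)) (\<lambda>z. fst z i \<otimes>\<^bsub>G i\<^esub> snd z i)" if i: "i \<in> I" for i
    using continuous_map_compose[OF continuous_map_fst component[OF i], of ?T]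
      continuous_map_compose[OF continuous_map_snd component[OF i], of ?T]
    by (intro topological_ab_group.continuous_map_mult[OF G[OF i]]) (simp_all add: o_def)
  then show "continuous_map (prod_topology (topo (top_product_group I G)) (topo (top_product_group I G)))
      (topo (top_product_group I G)) (\<lambda>z. fst z \<otimes>\<^bsub>top_product_group I G\<^esub> snd z)"
    by (auto simp: continuous_map_componentwise)
qed

text \<open>The coset map of a topological group is open because the preimage of the image of an open set
  is a union of translates. Closedness of the subgroup is what makes the quotient Hausdorff.\<close>

context topological_ab_group
begin

context
  fixes N assumes N: "subgroup N G" and cl: "closedin (topo G) N"
begin

lemma top_quotient_group_simps:
  "carrier (top_quotient_group G N) = (\<lambda>x. N #> x) ` carrier G"
  "monoid.mult (top_quotient_group G N) = set_mult G"
  "one (top_quotient_group G N) = N"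
  "topo (top_quotient_group G N) = quotient_topology (topo G) (\<lambda>x. N #> x)"
  by (auto simp: top_quotient_group_def FactGroup_def RCOSETS_def)

lemma comm_group_quotient: "comm_group (top_quotient_group G N)"
  by (rule comm_group_cong[OF abelian_FactGroup[OF N]]) (auto simp: top_quotient_group_def)

lemma coset_hom: "(\<lambda>x. N #> x) \<in> hom G (top_quotient_group G N)"
  using normal.r_coset_hom_Mod[OF normal_iff_subgroup[THEN iffD2, OF N]]
  by (auto simp: hom_def top_quotient_group_def)

lemma coset_eq_iff:
  assumes "x \<in> carrier G" "y \<in> carrier G"
  shows "N #> x = N #> y \<longleftrightarrow> x \<otimes> inv y \<in> N"
  by (metis N assms coset_join1 coset_join2 coset_mult_inv1 coset_mult_inv2 inv_closed m_closed
      subgroup.subset)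

lemma coset_quotient_map: "quotient_map (topo G) (topo (top_quotient_group G N)) (\<lambda>x. N #> x)"
  by (simp add: top_quotient_group_simps quotient_map_quotient_topology)

lemma coset_continuous: "continuous_map (topo G) (topo (top_quotient_group G N)) (\<lambda>x. N #> x)"
  by (rule quotient_imp_continuous_map[OF coset_quotient_map])

lemma coset_open_map: "open_map (topo G) (topo (top_quotient_group G N)) (\<lambda>x. N #> x)"
  unfolding open_map_def
proof (intro allI impI)
  fix U assume U: "openin (topo G) U"
  have NG: "N \<subseteq> carrier G" by (rule subgroup.subset[OF N])
  have "{x \<in> carrier G. N #> x \<in> (\<lambda>x. N #> x) ` U} = (\<Union>n\<in>N. {x \<in> carrier G. n \<otimes> x \<in> U})"
    (is "?L = ?R")
  proof (intro subset_antisym subsetI)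
    fix x assume "x \<in> ?L"
    then obtain u where x: "x \<in> carrier G" "u \<in> U" "N #> u = N #> x" by auto
    then have "u \<in> carrier G" using openin_carrier[OF U] by blast
    then have "u \<otimes> inv x \<in> N" using x coset_eq_iff by simp
    moreover have "u \<otimes> inv x \<otimes> x = u" using x(1) \<open>u \<in> carrier G\<close> by (simp add: m_assoc)
    ultimately show "x \<in> ?R" using x by force
  next
    fix x assume "x \<in> ?R"
    then obtain n where n: "n \<in> N" "x \<in> carrier G" "n \<otimes> x \<in> U" by blast
    then have "N #> (n \<otimes> x) = N #> x"
      using NG by (subst coset_eq_iff) (auto simp: m_assoc)
    then show "x \<in> ?L" using n by (metis (mono_tags, lifting) imageI mem_Collect_eq)
  qed
  moreover have "openin (topo G) ?R"
    using openin_translate[OF U] NG by (intro openin_Union) auto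
  ultimately have "openin (topo G) {x \<in> topspace (topo G). N #> x \<in> (\<lambda>x. N #> x) ` U}"
    by (simp add: topspace_topo)
  then show "openin (topo (top_quotient_group G N)) ((\<lambda>x. N #> x) ` U)"
    unfolding top_quotient_group_simps openin_quotient_topology
    using openin_subset[OF U] by (simp add: image_mono)
qed

lemma topological_ab_group_quotient: "topological_ab_group (top_quotient_group G N)"
proof -
  let ?Q = "top_quotient_group G N" and ?q = "\<lambda>x. N #> x"
  interpret Q: comm_group ?Q by (rule comm_group_quotient)
  interpret q: group_hom G ?Q ?q by unfold_locales (rule coset_hom)
  have top: "topspace (topo ?Q) = carrier ?Q"
    using quotient_imp_surjective_map[OF coset_quotient_map]
    by (simp add: topspace_topo top_quotient_group_simps)
  have openq: "openin (topo ?Q) (?q ` U)" if "openin (topo G) U" for U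
    using coset_open_map that by (simp add: open_map_def)
  show ?thesis
  proof (rule topological_ab_groupI[OF comm_group_quotient top])
    show "Hausdorff_space (topo ?Q)"
      unfolding Hausdorff_space_def
    proof (intro allI impI)
      fix A B assume AB: "A \<in> topspace (topo ?Q) \<and> B \<in> topspace (topo ?Q) \<and> A \<noteq> B"
      then have "A \<in> ?q ` carrier G" "B \<in> ?q ` carrier G"
        by (simp_all add: top top_quotient_group_simps(1))
      then obtain a b where ab: "a \<in> carrier G" "A = ?q a" "b \<in> carrier G" "B = ?q b"
        by (elim imageE)
      have "openin (topo G) (topspace (topo G) - N)" using cl by (simp add: closedin_def)
      moreover have "a \<otimes> inv b \<in> topspace (topo G) - N"
        using AB ab coset_eq_iff by (simp add: topspace_topo)
      ultimately obtain V W where VW: "openin (topo G) V" "a \<in> V" "openin (topo G) W" "b \<in> W"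
        "\<forall>x\<in>V. \<forall>y\<in>W. x \<otimes> inv y \<in> topspace (topo G) - N"
        by (rule nbhd_of_binary_op[OF continuous_map_div_pair _ _ ab(1,3)])
      have "disjnt (?q ` V) (?q ` W)"
      proof -
        have "?q x \<noteq> ?q y" if "x \<in> V" "y \<in> W" for x y
          using VW(5) coset_eq_iff openin_carrier[OF VW(1)] openin_carrier[OF VW(3)] that
          by auto
        then show ?thesis by (force simp: disjnt_iff)
      qed
      then show "\<exists>U V. openin (topo ?Q) U \<and> openin (topo ?Q) V \<and> A \<in> U \<and> B \<in> V \<and> disjnt U V"
        using openq[OF VW(1)] openq[OF VW(3)] VW(2,4) ab(2,4)
        by (intro exI[of _ "?q ` V"] exI[of _ "?q ` W"]) auto
    qed
    have "continuous_map (topo G) (topo ?Q) (\<lambda>x. ?q (inv x))"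
      using continuous_map_compose[OF continuous_inv coset_continuous] by (simp add: o_def)
    then have "continuous_map (topo G) (topo ?Q) (m_inv ?Q \<circ> ?q)"
      by (rule continuous_map_eq) (simp add: topspace_topo)
    then show "continuous_map (topo ?Q) (topo ?Q) (m_inv ?Q)"
      using continuous_compose_quotient_map[OF coset_quotient_map] by blast
    have "openin (prod_topology (topo ?Q) (topo ?Q)) {z \<in> carrier ?Q \<times> carrier ?Q. fst z \<otimes>\<^bsub>?Q\<^esub> snd z \<in> U}"
      if U: "openin (topo ?Q) U" for U
      unfolding openin_prod_topology_alt
    proof (intro allI impI)
      fix A B assume AB: "(A, B) \<in> {z \<in> carrier ?Q \<times> carrier ?Q. fst z \<otimes>\<^bsub>?Q\<^esub> snd z \<in> U}"
      then obtain a b where ab: "a \<in> carrier G" "A = ?q a" "b \<in> carrier G" "B = ?q b"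
        unfolding top_quotient_group_simps by auto
      have "openin (topo G) {x \<in> carrier G. ?q x \<in> U}"
        using openin_continuous_map_preimage[OF coset_continuous U] by (simp add: topspace_topo)
      moreover have "a \<otimes> b \<in> {x \<in> carrier G. ?q x \<in> U}" using AB ab by simp
      ultimately obtain V W where VW: "openin (topo G) V" "a \<in> V" "openin (topo G) W" "b \<in> W"
        "\<forall>x\<in>V. \<forall>y\<in>W. x \<otimes> y \<in> {x \<in> carrier G. ?q x \<in> U}"
        by (rule nbhd_of_binary_op[OF continuous_map_mult_pair _ _ ab(1,3)])
      have "?q ` V \<times> ?q ` W \<subseteq> {z \<in> carrier ?Q \<times> carrier ?Q. fst z \<otimes>\<^bsub>?Q\<^esub> snd z \<in> U}"
      proof
        fix z assume "z \<in> ?q ` V \<times> ?q ` W"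
        then obtain v w where vw: "v \<in> V" "w \<in> W" "z = (?q v, ?q w)" by auto
        have "v \<in> carrier G" "w \<in> carrier G"
          using vw openin_carrier[OF VW(1)] openin_carrier[OF VW(3)] by auto
        then show "z \<in> {z \<in> carrier ?Q \<times> carrier ?Q. fst z \<otimes>\<^bsub>?Q\<^esub> snd z \<in> U}"
          using VW(5) vw by (simp del: q.hom_mult add: q.hom_mult[symmetric])
      qed
      then show "\<exists>V W. openin (topo ?Q) V \<and> openin (topo ?Q) W \<and> A \<in> V \<and> B \<in> W \<and>
          V \<times> W \<subseteq> {z \<in> carrier ?Q \<times> carrier ?Q. fst z \<otimes>\<^bsub>?Q\<^esub> snd z \<in> U}"
        using openq[OF VW(1)] openq[OF VW(3)] VW(2,4) ab(2,4)
        by (intro exI[of _ "?q ` V"] exI[of _ "?q ` W"]) (simp only: image_eqI simp_thms)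
    qed
    then show "continuous_map (prod_topology (topo ?Q) (topo ?Q)) (topo ?Q) (\<lambda>z. fst z \<otimes>\<^bsub>?Q\<^esub> snd z)"
      by (auto simp: continuous_map_def top)
  qed
qed

end

end

section \<open>Extensions\<close>

lemma top_hom_iff: "f \<in> top_hom G H \<longleftrightarrow> f \<in> hom G H \<and> continuous_map (topo G) (topo H) f"
  by (simp add: top_hom_def)

lemma top_hom_compose: "f \<in> top_hom G H \<Longrightarrow> g \<in> top_hom H K \<Longrightarrow> (\<lambda>x. g (f x)) \<in> top_hom G K"
  using hom_compose[of f G H g K] continuous_map_compose[of "topo G" "topo H" f "topo K" g]
  by (simp add: top_hom_iff o_def)

locale group_extension =
  fixes G :: "'g topgroup" and H :: "'h topgroup" and E :: "('h, 'x, 'g) extension"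
  assumes ext: "is_extension G H E"

sublocale group_extension \<subseteq> G: topological_ab_group G
  using ext by (simp add: is_extension_def)
sublocale group_extension \<subseteq> H: topological_ab_group H
  using ext by (simp add: is_extension_def)
sublocale group_extension \<subseteq> X: topological_ab_group "total E"
  using ext by (simp add: is_extension_def)
sublocale group_extension \<subseteq> incl: group_hom H "total E" "incl E"
  using ext by unfold_locales (simp add: is_extension_def top_hom_iff)
sublocale group_extension \<subseteq> proj: group_hom "total E" G "proj E"
  using ext by unfold_locales (simp add: is_extension_def top_hom_iff)

context group_extension
begin

lemma incl_continuous: "continuous_map (topo H) (topo (total E)) (incl E)"
  and proj_continuous: "continuous_map (topo (total E)) (topo G) (proj E)"
  and incl_open_map: "open_onto_image H (total E) (incl E)"
  and proj_open_map: "open_onto_image (total E) G (proj E)"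
  and incl_inj: "inj_on (incl E) (carrier H)"
  and incl_image: "incl E ` carrier H = kernel (total E) G (proj E)"
  and proj_image: "proj E ` carrier (total E) = carrier G"
  using ext by (simp_all add: is_extension_def top_hom_iff)

lemma proj_incl [simp]: "h \<in> carrier H \<Longrightarrow> proj E (incl E h) = \<one>\<^bsub>G\<^esub>"
  using incl_image by (auto simp: kernel_def)

lemma lift:
  assumes "g \<in> carrier G"
  obtains x where "x \<in> carrier (total E)" "proj E x = g"
  using assms proj_image by (metis imageE)

lemma fibre:
  assumes "x \<in> carrier (total E)" "y \<in> carrier (total E)" "proj E x = proj E y"
  obtains h where "h \<in> carrier H" "x = y \<otimes>\<^bsub>total E\<^esub> incl E h"
proof -
  have "inv\<^bsub>total E\<^esub> y \<otimes>\<^bsub>total E\<^esub> x \<in> kernel (total E) G (proj E)"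
    using assms by (simp add: kernel_def)
  then obtain h where h: "h \<in> carrier H" "inv\<^bsub>total E\<^esub> y \<otimes>\<^bsub>total E\<^esub> x = incl E h"
    unfolding incl_image[symmetric] by (elim imageE)
  have "y \<otimes>\<^bsub>total E\<^esub> incl E h = x"
    using assms h(2)[symmetric] by (simp add: X.m_assoc[symmetric])
  then show thesis by (intro that[OF h(1)]) simp
qed

lemma incl_open:
  assumes "openin (topo H) V"
  obtains W where "openin (topo (total E)) W" "\<forall>h\<in>carrier H. incl E h \<in> W \<longleftrightarrow> h \<in> V"
proof -
  have "openin (subtopology (topo (total E)) (incl E ` carrier H)) (incl E ` V)"
    using incl_open_map assms by (simp add: open_onto_image_def open_map_def)
  then obtain W where W: "openin (topo (total E)) W" "incl E ` V = W \<inter> incl E ` carrier H"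
    by (auto simp: openin_subtopology)
  moreover have "incl E h \<in> incl E ` V \<longleftrightarrow> h \<in> V" if "h \<in> carrier H" for h
    using inj_on_image_mem_iff[OF incl_inj that] H.openin_carrier[OF assms] by blast
  ultimately show thesis by (intro that[of W]) auto
qed

lemma proj_open:
  assumes "openin (topo (total E)) U"
  shows "openin (topo G) (proj E ` U)"
proof -
  have "openin (subtopology (topo G) (carrier G)) (proj E ` U)"
    using proj_open_map assms by (simp add: open_onto_image_def open_map_def proj_image)
  then show ?thesis by (simp add: G.topspace_topo[symmetric])
qed

end

text \<open>Since the maps are homomorphisms, injectivity and openness can be tested at the identity.\<close>

lemma is_extensionI:
  assumes G: "topological_ab_group G" and H: "topological_ab_group H"
    and X: "topological_ab_group (total E)"
    and i: "incl E \<in> hom H (total E)" "continuous_map (topo H) (topo (total E)) (incl E)"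
    and q: "proj E \<in> hom (total E) G" "continuous_map (topo (total E)) (topo G) (proj E)"
    and inj: "\<And>h. h \<in> carrier H \<Longrightarrow> incl E h = \<one>\<^bsub>total E\<^esub> \<Longrightarrow> h = \<one>\<^bsub>H\<^esub>"
    and qi: "\<And>h. h \<in> carrier H \<Longrightarrow> proj E (incl E h) = \<one>\<^bsub>G\<^esub>"
    and ker: "\<And>x. x \<in> carrier (total E) \<Longrightarrow> proj E x = \<one>\<^bsub>G\<^esub> \<Longrightarrow> \<exists>h\<in>carrier H. x = incl E h"
    and surj: "\<And>g. g \<in> carrier G \<Longrightarrow> \<exists>x\<in>carrier (total E). proj E x = g"
    and i_open: "\<And>V. openin (topo H) V \<Longrightarrow> \<one>\<^bsub>H\<^esub> \<in> V \<Longrightarrow>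
      \<exists>W. openin (topo (total E)) W \<and> \<one>\<^bsub>total E\<^esub> \<in> W \<and> (\<forall>h\<in>carrier H. incl E h \<in> W \<longrightarrow> h \<in> V)"
    and q_open: "\<And>U. openin (topo (total E)) U \<Longrightarrow> \<one>\<^bsub>total E\<^esub> \<in> U \<Longrightarrow>
      \<exists>W. openin (topo G) W \<and> \<one>\<^bsub>G\<^esub> \<in> W \<and> W \<subseteq> proj E ` U"
  shows "is_extension G H E"
proof -
  interpret G: topological_ab_group G by (rule G)
  interpret H: topological_ab_group H by (rule H)
  interpret X: topological_ab_group "total E" by (rule X)
  interpret i: group_hom H "total E" "incl E" by unfold_locales (rule i)
  interpret q: group_hom "total E" G "proj E" by unfold_locales (rule q)
  show ?thesis
    unfolding is_extension_def top_hom_iff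
  proof (intro conjI G H X i q)
    show "open_onto_image H (total E) (incl E)"
      by (rule open_onto_image_at_one[OF H X i(1)]) (use i_open in fast)
    show "open_onto_image (total E) G (proj E)"
      by (rule open_onto_image_at_one[OF X G q(1)]) (use q_open in fast)
    show "inj_on (incl E) (carrier H)"
      using inj by (simp add: i.inj_on_one_iff)
    show "incl E ` carrier H = kernel (total E) G (proj E)"
      using qi ker by (auto simp: kernel_def)
    show "proj E ` carrier (total E) = carrier G"
      using surj by force
  qed
qed

section \<open>Morphisms of extensions\<close>

text \<open>Morphisms that are the identity on the quotient group and a prescribed map \<open>f\<close> on the kernels.
  For \<open>f\<close> the identity they are the equivalences of extensions.\<close>

definition ext_morphism ::
  "'k topgroup \<Rightarrow> ('k \<Rightarrow> 'h) \<Rightarrow> ('k, 'y, 'g) extension \<Rightarrow> ('h, 'x, 'g) extension \<Rightarrow> bool" where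
  "ext_morphism K f F E \<longleftrightarrow>
     (\<exists>T\<in>top_hom (total F) (total E).
        (\<forall>k\<in>carrier K. T (incl F k) = incl E (f k)) \<and>
        (\<forall>y\<in>carrier (total F). proj E (T y) = proj F y))"

lemma ext_equiv_iff:
  "ext_equiv G H E E' \<longleftrightarrow>
     is_extension G H E \<and> is_extension G H E' \<and> ext_morphism H (\<lambda>h. h) E E'"
  by (simp add: ext_equiv_def ext_morphism_def)

lemma ext_morphism_refl: "ext_morphism K (\<lambda>k. k) F F"
  unfolding ext_morphism_def
  by (intro bexI[of _ "\<lambda>x. x"]) (auto simp: top_hom_iff hom_def)

lemma ext_morphism_trans:
  assumes "ext_morphism K f F E" "ext_morphism H g E D" "f \<in> carrier K \<rightarrow> carrier H"
  shows "ext_morphism K (\<lambda>k. g (f k)) F D"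
proof -
  obtain S where S: "S \<in> top_hom (total F) (total E)" "\<forall>k\<in>carrier K. S (incl F k) = incl E (f k)"
    "\<forall>y\<in>carrier (total F). proj E (S y) = proj F y"
    using assms(1) by (auto simp: ext_morphism_def)
  obtain T where T: "T \<in> top_hom (total E) (total D)" "\<forall>h\<in>carrier H. T (incl E h) = incl D (g h)"
    "\<forall>y\<in>carrier (total E). proj D (T y) = proj E y"
    using assms(2) by (auto simp: ext_morphism_def)
  have "S y \<in> carrier (total E)" if "y \<in> carrier (total F)" for y
    using S(1) that by (auto simp: top_hom_iff hom_def)
  then show ?thesis
    unfolding ext_morphism_def using top_hom_compose[OF S(1) T(1)] S T assms(3)
    by (intro bexI[of _ "\<lambda>x. T (S x)"]) auto
qed

lemma ext_morphism_cong:
  assumes "ext_morphism K f F E" "\<And>k. k \<in> carrier K \<Longrightarrow> f k = g k"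
  shows "ext_morphism K g F E"
  using assms by (simp add: ext_morphism_def)

text \<open>A morphism over \<open>f\<close> exhibits its target as the push-out of its source along \<open>f\<close>. Indeed, the
  map \<open>total F \<times> H \<rightarrow> total E\<close>, \<open>(y, h) \<mapsto> T y + \<i> h\<close> is surjective, its kernel depends on \<open>f\<close> only, and
  it is open because \<open>\<i>\<close> is open onto its image and the projection of \<open>F\<close> is open. Hence both targets
  carry the same quotient of \<open>total F \<times> H\<close>, and the equivalence is \<open>T y + \<i> h \<mapsto> T' y + \<i>' h\<close>.\<close>

lemma ext_morphism_determines_target:
  assumes F: "is_extension G K F" and E: "is_extension G H E" and E': "is_extension G H E'"
    and f: "f \<in> carrier K \<rightarrow> carrier H"
    and FE: "ext_morphism K f F E" and FE': "ext_morphism K f F E'"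
  shows "ext_equiv G H E E'"
proof -
  interpret F: group_extension G K F by (rule group_extension.intro[OF F])
  interpret E: group_extension G H E by (rule group_extension.intro[OF E])
  interpret E': group_extension G H E' by (rule group_extension.intro[OF E'])
  obtain T where T: "T \<in> hom (total F) (total E)" "continuous_map (topo (total F)) (topo (total E)) T"
    and Ti: "\<And>k. k \<in> carrier K \<Longrightarrow> T (incl F k) = incl E (f k)"
    and Tq: "\<And>y. y \<in> carrier (total F) \<Longrightarrow> proj E (T y) = proj F y"
    using FE by (auto simp: ext_morphism_def top_hom_iff)
  obtain T' where T': "T' \<in> hom (total F) (total E')"
      "continuous_map (topo (total F)) (topo (total E')) T'"
    and Ti': "\<And>k. k \<in> carrier K \<Longrightarrow> T' (incl F k) = incl E' (f k)"
    and Tq': "\<And>y. y \<in> carrier (total F) \<Longrightarrow> proj E' (T' y) = proj F y"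
    using FE' by (auto simp: ext_morphism_def top_hom_iff)
  interpret T: group_hom "total F" "total E" T by unfold_locales (rule T)
  interpret T': group_hom "total F" "total E'" T' by unfold_locales (rule T')
  let ?P = "\<lambda>y h. T y \<otimes>\<^bsub>total E\<^esub> incl E h" and ?P' = "\<lambda>y h. T' y \<otimes>\<^bsub>total E'\<^esub> incl E' h"
  have decomp: "\<exists>h\<in>carrier H. x = ?P y h"
    if "x \<in> carrier (total E)" "y \<in> carrier (total F)" "proj F y = proj E x" for x y
    by (rule E.fibre[of x "T y"]) (use that Tq in auto)
  have "\<exists>z. \<exists>y\<in>carrier (total F). \<exists>h\<in>carrier H. x = ?P y h \<and> z = ?P' y h"
    if x: "x \<in> carrier (total E)" for x
    using decomp[OF x] F.lift[OF E.proj.hom_closed[OF x]] by metis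
  then obtain S where S: "\<And>x. x \<in> carrier (total E) \<Longrightarrow>
      \<exists>y\<in>carrier (total F). \<exists>h\<in>carrier H. x = ?P y h \<and> S x = ?P' y h"
    by metis
  have well_defined: "?P' y h = ?P' z k"
    if yz: "y \<in> carrier (total F)" "z \<in> carrier (total F)"
      and hk: "h \<in> carrier H" "k \<in> carrier H" and eq: "?P y h = ?P z k" for y z h k
  proof -
    have "proj E (?P y h) = proj E (?P z k)" using eq by simp
    then have "proj F z = proj F y" using yz hk by (simp add: Tq)
    then obtain l where l: "l \<in> carrier K" "z = y \<otimes>\<^bsub>total F\<^esub> incl F l"
      using F.fibre yz by blast
    have fl: "f l \<in> carrier H" using f l by auto
    have "T y \<otimes>\<^bsub>total E\<^esub> incl E h = T y \<otimes>\<^bsub>total E\<^esub> incl E (f l \<otimes>\<^bsub>H\<^esub> k)"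
      using eq yz hk l fl by (simp add: Ti E.X.m_assoc)
    then have "incl E h = incl E (f l \<otimes>\<^bsub>H\<^esub> k)" using yz hk fl by simp
    then have "h = f l \<otimes>\<^bsub>H\<^esub> k"
      using inj_onD[OF E.incl_inj] hk fl by simp
    then show ?thesis using yz hk l fl by (simp add: Ti' E'.X.m_assoc)
  qed
  have S_eq: "S (?P y h) = ?P' y h" if yh: "y \<in> carrier (total F)" "h \<in> carrier H" for y h
  proof -
    obtain z k where "z \<in> carrier (total F)" "k \<in> carrier H" "?P y h = ?P z k" "S (?P y h) = ?P' z k"
      using S[of "?P y h"] yh by auto
    then show ?thesis using well_defined[OF yh(1) _ yh(2)] by simp
  qed
  have S_hom: "S \<in> hom (total E) (total E')"
  proof (rule homI)
    fix x x' assume xx: "x \<in> carrier (total E)" "x' \<in> carrier (total E)"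
    obtain y h where y: "y \<in> carrier (total F)" "h \<in> carrier H" "x = ?P y h" "S x = ?P' y h"
      using S[OF xx(1)] by blast
    obtain y' h' where y': "y' \<in> carrier (total F)" "h' \<in> carrier H" "x' = ?P y' h'" "S x' = ?P' y' h'"
      using S[OF xx(2)] by blast
    show "S x \<in> carrier (total E')" using y by simp
    have "x \<otimes>\<^bsub>total E\<^esub> x' = ?P (y \<otimes>\<^bsub>total F\<^esub> y') (h \<otimes>\<^bsub>H\<^esub> h')"
      using y y' by (simp add: E.X.m_ac)
    then have "S (x \<otimes>\<^bsub>total E\<^esub> x') = ?P' (y \<otimes>\<^bsub>total F\<^esub> y') (h \<otimes>\<^bsub>H\<^esub> h')"
      using S_eq[of "y \<otimes>\<^bsub>total F\<^esub> y'" "h \<otimes>\<^bsub>H\<^esub> h'"] y(1,2) y'(1,2) by simp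
    also have "\<dots> = S x \<otimes>\<^bsub>total E'\<^esub> S x'"
      using y(1,2) y'(1,2) by (simp add: y(4) y'(4) E'.X.m_ac)
    finally show "S (x \<otimes>\<^bsub>total E\<^esub> x') = S x \<otimes>\<^bsub>total E'\<^esub> S x'" .
  qed
  have S_continuous: "continuous_map (topo (total E)) (topo (total E')) S"
  proof (rule hom_continuous_at_one[OF E.X.topological_ab_group_axioms E'.X.topological_ab_group_axioms S_hom])
    fix U assume U: "openin (topo (total E')) U" "\<one>\<^bsub>total E'\<^esub> \<in> U"
    then obtain V where V: "openin (topo (total E')) V" "\<one>\<^bsub>total E'\<^esub> \<in> V"
      "\<forall>x\<in>V. \<forall>y\<in>V. x \<otimes>\<^bsub>total E'\<^esub> y \<in> U"
      by (rule E'.X.one_nbhd_mult)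
    \<comment> \<open>If \<open>y\<close> and \<open>h\<close> are small, then so is the image \<open>T' y + \<i>' h\<close> of \<open>T y + \<i> h\<close>. It remains to write
      every small \<open>x\<close> as \<open>T y + \<i> h\<close> with small \<open>y\<close> and \<open>h\<close>: openness of the projection provides \<open>y\<close>,
      and then \<open>\<i> h = x - T y\<close> is small, hence so is \<open>h\<close>.\<close>
    define A where "A = {y \<in> carrier (total F). T' y \<in> V}"
    define B where "B = {h \<in> carrier H. incl E' h \<in> V}"
    have A: "openin (topo (total F)) A" "\<one>\<^bsub>total F\<^esub> \<in> A"
      using openin_continuous_map_preimage[OF T'(2) V(1)] V(2)
      by (auto simp: A_def F.X.topspace_topo)
    have B: "openin (topo H) B" "\<one>\<^bsub>H\<^esub> \<in> B"
      using openin_continuous_map_preimage[OF E'.incl_continuous V(1)] V(2)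
      by (auto simp: B_def E.H.topspace_topo)
    obtain C where C: "openin (topo (total E)) C" "\<forall>h\<in>carrier H. incl E h \<in> C \<longleftrightarrow> h \<in> B"
      by (rule E.incl_open[OF B(1)])
    then have "\<one>\<^bsub>total E\<^esub> \<in> C" using B(2) E.incl.hom_one E.H.one_closed by metis
    then obtain D where D: "openin (topo (total E)) D" "\<one>\<^bsub>total E\<^esub> \<in> D"
      "\<forall>x\<in>D. \<forall>y\<in>D. x \<otimes>\<^bsub>total E\<^esub> inv\<^bsub>total E\<^esub> y \<in> C"
      by (rule E.X.one_nbhd_div[OF C(1)])
    define A' where "A' = A \<inter> {y \<in> carrier (total F). T y \<in> D}"
    have A': "openin (topo (total F)) A'" "\<one>\<^bsub>total F\<^esub> \<in> A'"
      using openin_continuous_map_preimage[OF T(2) D(1)] A D(2)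
      by (auto simp: A'_def F.X.topspace_topo)
    define W where "W = D \<inter> {x \<in> carrier (total E). proj E x \<in> proj F ` A'}"
    have "openin (topo (total E)) W"
      using openin_continuous_map_preimage[OF E.proj_continuous F.proj_open[OF A'(1)]] D(1)
      by (auto simp: W_def E.X.topspace_topo)
    moreover have "\<one>\<^bsub>total E\<^esub> \<in> W"
      using D(2) A'(2) by (force simp: W_def image_iff)
    moreover have "S x \<in> U" if x: "x \<in> W" for x
    proof -
      obtain y where y: "x \<in> carrier (total E)" "x \<in> D" "y \<in> A'" "proj E x = proj F y"
        using x by (auto simp: W_def)
      then have yF: "y \<in> carrier (total F)" "T' y \<in> V" "T y \<in> D" by (auto simp: A'_def A_def)
      obtain h where h: "h \<in> carrier H" "x = ?P y h"
        using decomp[OF y(1) yF(1)] y(4) by auto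
      then have "x \<otimes>\<^bsub>total E\<^esub> inv\<^bsub>total E\<^esub> T y = incl E h"
        using yF(1) by (simp add: E.X.m_comm[of "T y"] E.X.m_assoc)
      then have "h \<in> B" using D(3) y(2) yF(3) C(2) h(1) by metis
      then have "incl E' h \<in> V" by (simp add: B_def)
      then show ?thesis using V(3) yF(2) S_eq[OF yF(1) h(1)] h(2) by simp
    qed
    ultimately show "\<exists>W. openin (topo (total E)) W \<and> \<one>\<^bsub>total E\<^esub> \<in> W \<and> S ` W \<subseteq> U"
      by auto
  qed
  have "S (incl E h) = incl E' h" if "h \<in> carrier H" for h
    using S_eq[of "\<one>\<^bsub>total F\<^esub>" h] that by simp
  moreover have "proj E' (S x) = proj E x" if "x \<in> carrier (total E)" for x
  proof -
    obtain y h where y: "y \<in> carrier (total F)" "h \<in> carrier H" "x = ?P y h" "S x = ?P' y h"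
      using S[OF \<open>x \<in> carrier (total E)\<close>] by blast
    have "proj E' (S x) = proj F y" using y(1,2) by (simp add: y(4) Tq')
    moreover have "proj E x = proj F y" using y(1,2) by (simp add: y(3) Tq)
    ultimately show ?thesis by simp
  qed
  ultimately show ?thesis
    unfolding ext_equiv_iff ext_morphism_def using E E' S_hom S_continuous
    by (auto simp: top_hom_iff intro!: bexI[of _ S])
qed

text \<open>An equivalence is by definition only a continuous homomorphism in one direction. The continuous
  inverse comes from comparing it with the identity of its source.\<close>

lemma ext_equiv_sym: "ext_equiv G H E E' \<Longrightarrow> ext_equiv G H E' E"
  by (rule ext_morphism_determines_target[where K = H and f = "\<lambda>h. h" and F = E])
    (auto simp: ext_equiv_iff ext_morphism_refl)

lemma ext_equiv_trans: "ext_equiv G H E E' \<Longrightarrow> ext_equiv G H E' E'' \<Longrightarrow> ext_equiv G H E E''"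
  using ext_morphism_trans[of H "\<lambda>h. h" E E' H "\<lambda>h. h" E''] by (auto simp: ext_equiv_iff)

section \<open>Constructions of extensions\<close>

lemma product_ext_simps [simp]:
  "total (product_ext E1 E2) = top_DirProd (total E1) (total E2)"
  "incl (product_ext E1 E2) = map_prod (incl E1) (incl E2)"
  "proj (product_ext E1 E2) = map_prod (proj E1) (proj E2)"
  by (simp_all add: product_ext_def)

lemma continuous_map_map_prod:
  assumes "continuous_map A A' f" "continuous_map B B' g"
  shows "continuous_map (prod_topology A B) (prod_topology A' B') (map_prod f g)"
proof -
  have "continuous_map (prod_topology A B) (prod_topology A' B') (\<lambda>z. ((f \<circ> fst) z, (g \<circ> snd) z))"
    using assms by (intro continuous_map_pairedI continuous_map_compose[OF continuous_map_fst]
      continuous_map_compose[OF continuous_map_snd])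
  then show ?thesis by (simp add: map_prod_def case_prod_unfold)
qed

lemma is_extension_product_ext:
  assumes 1: "is_extension G1 H1 E1" and 2: "is_extension G2 H2 E2"
  shows "is_extension (top_DirProd G1 G2) (top_DirProd H1 H2) (product_ext E1 E2)"
proof -
  interpret E1: group_extension G1 H1 E1 by (rule group_extension.intro[OF 1])
  interpret E2: group_extension G2 H2 E2 by (rule group_extension.intro[OF 2])
  show ?thesis
  proof (rule is_extensionI, unfold product_ext_simps)
    show "topological_ab_group (top_DirProd G1 G2)" "topological_ab_group (top_DirProd H1 H2)"
      "topological_ab_group (top_DirProd (total E1) (total E2))"
      by (rule topological_ab_group_DirProd; unfold_locales)+
    show "map_prod (incl E1) (incl E2) \<in> hom (top_DirProd H1 H2) (top_DirProd (total E1) (total E2))"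
      "map_prod (proj E1) (proj E2) \<in> hom (top_DirProd (total E1) (total E2)) (top_DirProd G1 G2)"
      by (auto simp: hom_def)
    show "continuous_map (topo (top_DirProd H1 H2)) (topo (top_DirProd (total E1) (total E2)))
        (map_prod (incl E1) (incl E2))"
      by (simp add: continuous_map_map_prod E1.incl_continuous E2.incl_continuous)
    show "continuous_map (topo (top_DirProd (total E1) (total E2))) (topo (top_DirProd G1 G2))
        (map_prod (proj E1) (proj E2))"
      by (simp add: continuous_map_map_prod E1.proj_continuous E2.proj_continuous)
    fix h assume h: "h \<in> carrier (top_DirProd H1 H2)"
    show "map_prod (proj E1) (proj E2) (map_prod (incl E1) (incl E2) h) = \<one>\<^bsub>top_DirProd G1 G2\<^esub>"
      using h by auto
    assume "map_prod (incl E1) (incl E2) h = \<one>\<^bsub>top_DirProd (total E1) (total E2)\<^esub>"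
    then show "h = \<one>\<^bsub>top_DirProd H1 H2\<^esub>"
      using h E1.incl_inj E2.incl_inj by (auto simp: E1.incl.inj_on_one_iff E2.incl.inj_on_one_iff)
  next
    fix x assume x: "x \<in> carrier (top_DirProd (total E1) (total E2))"
      "map_prod (proj E1) (proj E2) x = \<one>\<^bsub>top_DirProd G1 G2\<^esub>"
    obtain h1 where "h1 \<in> carrier H1" "fst x = \<one>\<^bsub>total E1\<^esub> \<otimes>\<^bsub>total E1\<^esub> incl E1 h1"
      by (rule E1.fibre[of "fst x" "\<one>\<^bsub>total E1\<^esub>"]) (use x in auto)
    moreover obtain h2 where "h2 \<in> carrier H2" "snd x = \<one>\<^bsub>total E2\<^esub> \<otimes>\<^bsub>total E2\<^esub> incl E2 h2"
      by (rule E2.fibre[of "snd x" "\<one>\<^bsub>total E2\<^esub>"]) (use x in auto)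
    ultimately show "\<exists>h\<in>carrier (top_DirProd H1 H2). x = map_prod (incl E1) (incl E2) h"
      by (intro bexI[of _ "(h1, h2)"]) (auto simp: prod_eq_iff)
  next
    fix g assume g: "g \<in> carrier (top_DirProd G1 G2)"
    obtain x1 where "x1 \<in> carrier (total E1)" "proj E1 x1 = fst g"
      by (rule E1.lift[of "fst g"]) (use g in auto)
    moreover obtain x2 where "x2 \<in> carrier (total E2)" "proj E2 x2 = snd g"
      by (rule E2.lift[of "snd g"]) (use g in auto)
    ultimately show "\<exists>x\<in>carrier (top_DirProd (total E1) (total E2)). map_prod (proj E1) (proj E2) x = g"
      by (intro bexI[of _ "(x1, x2)"]) auto
  next
    fix V assume "openin (topo (top_DirProd H1 H2)) V" "\<one>\<^bsub>top_DirProd H1 H2\<^esub> \<in> V"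
    then obtain V1 V2 where V: "openin (topo H1) V1" "openin (topo H2) V2" "\<one>\<^bsub>H1\<^esub> \<in> V1" "\<one>\<^bsub>H2\<^esub> \<in> V2"
      "V1 \<times> V2 \<subseteq> V"
      unfolding top_DirProd_simps by (rule openin_prod_box)
    obtain W1 where W1: "openin (topo (total E1)) W1" "\<forall>h\<in>carrier H1. incl E1 h \<in> W1 \<longleftrightarrow> h \<in> V1"
      by (rule E1.incl_open[OF V(1)])
    obtain W2 where W2: "openin (topo (total E2)) W2" "\<forall>h\<in>carrier H2. incl E2 h \<in> W2 \<longleftrightarrow> h \<in> V2"
      by (rule E2.incl_open[OF V(2)])
    have "\<one>\<^bsub>total E1\<^esub> \<in> W1" "\<one>\<^bsub>total E2\<^esub> \<in> W2"
      using W1(2) W2(2) V(3,4) E1.incl.hom_one E2.incl.hom_one E1.H.one_closed E2.H.one_closed by metis+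
    then show "\<exists>W. openin (topo (top_DirProd (total E1) (total E2))) W \<and>
        \<one>\<^bsub>top_DirProd (total E1) (total E2)\<^esub> \<in> W \<and>
        (\<forall>h\<in>carrier (top_DirProd H1 H2). map_prod (incl E1) (incl E2) h \<in> W \<longrightarrow> h \<in> V)"
      using V(5) W1 W2 by (intro exI[of _ "W1 \<times> W2"]) (auto simp: openin_prod_Times_iff)
  next
    fix U assume "openin (topo (top_DirProd (total E1) (total E2))) U"
      "\<one>\<^bsub>top_DirProd (total E1) (total E2)\<^esub> \<in> U"
    then obtain U1 U2 where U: "openin (topo (total E1)) U1" "openin (topo (total E2)) U2"
      "\<one>\<^bsub>total E1\<^esub> \<in> U1" "\<one>\<^bsub>total E2\<^esub> \<in> U2" "U1 \<times> U2 \<subseteq> U"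
      unfolding top_DirProd_simps by (rule openin_prod_box)
    have "\<one>\<^bsub>G1\<^esub> \<in> proj E1 ` U1" "\<one>\<^bsub>G2\<^esub> \<in> proj E2 ` U2"
      using U(3,4) by (metis image_eqI E1.proj.hom_one) (metis U(4) image_eqI E2.proj.hom_one)
    moreover have "proj E1 ` U1 \<times> proj E2 ` U2 \<subseteq> map_prod (proj E1) (proj E2) ` U"
      using U(5) by (auto 0 3 intro: rev_image_eqI)
    ultimately show "\<exists>W. openin (topo (top_DirProd G1 G2)) W \<and> \<one>\<^bsub>top_DirProd G1 G2\<^esub> \<in> W \<and>
        W \<subseteq> map_prod (proj E1) (proj E2) ` U"
      using E1.proj_open[OF U(1)] E2.proj_open[OF U(2)]
      by (intro exI[of _ "proj E1 ` U1 \<times> proj E2 ` U2"]) (auto simp: openin_prod_Times_iff)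
  qed
qed

lemma pullback_ext_simps [simp]:
  "total (pullback_ext G' f E) = top_subgroup (top_DirProd (total E) G')
     {(x, g). x \<in> carrier (total E) \<and> g \<in> carrier G' \<and> proj E x = f g}"
  "incl (pullback_ext G' f E) = (\<lambda>h. (incl E h, \<one>\<^bsub>G'\<^esub>))"
  "proj (pullback_ext G' f E) = snd"
  by (simp_all add: pullback_ext_def)

lemma is_extension_pullback_ext:
  assumes E: "is_extension G H E" and G': "topological_ab_group G'" and f: "f \<in> top_hom G' G"
  shows "is_extension G' H (pullback_ext G' f E)"
proof -
  interpret E: group_extension G H E by (rule group_extension.intro[OF E])
  interpret G': topological_ab_group G' by (rule G')
  interpret f: group_hom G' G f by unfold_locales (use f in \<open>simp add: top_hom_iff\<close>)
  have f_cont: "continuous_map (topo G') (topo G) f" using f by (simp add: top_hom_iff)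
  let ?D = "top_DirProd (total E) G'"
  let ?S = "{(x, g). x \<in> carrier (total E) \<and> g \<in> carrier G' \<and> proj E x = f g}"
  have D: "topological_ab_group ?D"
    by (rule topological_ab_group_DirProd; unfold_locales)
  then interpret D: topological_ab_group ?D .
  have S: "subgroup ?S ?D"
    by (rule D.subgroupI) (auto intro!: exI[of _ "\<one>\<^bsub>total E\<^esub>"] exI[of _ "\<one>\<^bsub>G'\<^esub>"])
  show ?thesis
  proof (rule is_extensionI, unfold pullback_ext_simps)
    show "topological_ab_group (top_subgroup ?D ?S)"
      by (rule topological_ab_group_subgroup[OF D S])
    show "topological_ab_group G'" "topological_ab_group H" by unfold_locales
    show "(\<lambda>h. (incl E h, \<one>\<^bsub>G'\<^esub>)) \<in> hom H (top_subgroup ?D ?S)"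
      "snd \<in> hom (top_subgroup ?D ?S) G'"
      by (auto simp: hom_def)
    show "continuous_map (topo H) (topo (top_subgroup ?D ?S)) (\<lambda>h. (incl E h, \<one>\<^bsub>G'\<^esub>))"
      by (auto simp: continuous_map_in_subtopology E.H.topspace_topo G'.topspace_topo
          intro!: continuous_map_pairedI E.incl_continuous)
    show "continuous_map (topo (top_subgroup ?D ?S)) (topo G') snd"
      by (simp add: continuous_map_from_subtopology continuous_map_snd)
    fix h assume h: "h \<in> carrier H"
    show "snd (incl E h, \<one>\<^bsub>G'\<^esub>) = \<one>\<^bsub>G'\<^esub>" by simp
    assume "(incl E h, \<one>\<^bsub>G'\<^esub>) = \<one>\<^bsub>top_subgroup ?D ?S\<^esub>"
    then show "h = \<one>\<^bsub>H\<^esub>"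
      using h E.incl_inj by (auto simp: E.incl.inj_on_one_iff)
  next
    fix z assume z: "z \<in> carrier (top_subgroup ?D ?S)" "snd z = \<one>\<^bsub>G'\<^esub>"
    obtain h where "h \<in> carrier H" "fst z = \<one>\<^bsub>total E\<^esub> \<otimes>\<^bsub>total E\<^esub> incl E h"
      by (rule E.fibre[of "fst z" "\<one>\<^bsub>total E\<^esub>"]) (use z in auto)
    then show "\<exists>h\<in>carrier H. z = (incl E h, \<one>\<^bsub>G'\<^esub>)"
      using z(2) by (intro bexI[of _ h]) (auto simp: prod_eq_iff)
  next
    fix g assume g: "g \<in> carrier G'"
    obtain x where "x \<in> carrier (total E)" "proj E x = f g"
      by (rule E.lift[of "f g"]) (use g in auto)
    then show "\<exists>z\<in>carrier (top_subgroup ?D ?S). snd z = g"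
      using g by (intro bexI[of _ "(x, g)"]) auto
  next
    fix V assume V: "openin (topo H) V" "\<one>\<^bsub>H\<^esub> \<in> V"
    obtain W where W: "openin (topo (total E)) W" "\<forall>h\<in>carrier H. incl E h \<in> W \<longleftrightarrow> h \<in> V"
      by (rule E.incl_open[OF V(1)])
    have "\<one>\<^bsub>total E\<^esub> \<in> W" using W(2) V(2) E.incl.hom_one E.H.one_closed by metis
    moreover have "openin (prod_topology (topo (total E)) (topo G')) (W \<times> carrier G')"
      using W(1) G'.topspace_topo openin_topspace[of "topo G'"] by (auto simp: openin_prod_Times_iff)
    ultimately show "\<exists>W. openin (topo (top_subgroup ?D ?S)) W \<and> \<one>\<^bsub>top_subgroup ?D ?S\<^esub> \<in> W \<and>
        (\<forall>h\<in>carrier H. (incl E h, \<one>\<^bsub>G'\<^esub>) \<in> W \<longrightarrow> h \<in> V)"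
      using W by (intro exI[of _ "(W \<times> carrier G') \<inter> ?S"]) (auto simp: openin_subtopology_Int)
  next
    fix U assume U: "openin (topo (top_subgroup ?D ?S)) U" "\<one>\<^bsub>top_subgroup ?D ?S\<^esub> \<in> U"
    then obtain O' where O': "openin (prod_topology (topo (total E)) (topo G')) O'" "U = O' \<inter> ?S"
      by (auto simp: openin_subtopology)
    have "(\<one>\<^bsub>total E\<^esub>, \<one>\<^bsub>G'\<^esub>) \<in> O'" using U(2) O'(2) by simp
    with O'(1) obtain A B where AB: "openin (topo (total E)) A" "openin (topo G') B"
      "\<one>\<^bsub>total E\<^esub> \<in> A" "\<one>\<^bsub>G'\<^esub> \<in> B" "A \<times> B \<subseteq> O'"
      by (rule openin_prod_box)
    let ?W = "B \<inter> {g \<in> topspace (topo G'). f g \<in> proj E ` A}"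
    have "openin (topo G') ?W"
      using AB(2) openin_continuous_map_preimage[OF f_cont E.proj_open[OF AB(1)]] by auto
    moreover have "\<one>\<^bsub>G\<^esub> \<in> proj E ` A" using AB(3) by (metis image_eqI E.proj.hom_one)
    then have "\<one>\<^bsub>G'\<^esub> \<in> ?W" using AB(4) by (simp add: G'.topspace_topo)
    moreover have "?W \<subseteq> snd ` U"
    proof
      fix g assume g: "g \<in> ?W"
      then obtain x where x: "x \<in> A" "proj E x = f g" by (auto simp: image_iff)
      then have "(x, g) \<in> U"
        using g AB(5) E.X.openin_carrier[OF AB(1)] by (auto simp: O'(2) G'.topspace_topo)
      then show "g \<in> snd ` U" by force
    qed
    ultimately show "\<exists>W. openin (topo G') W \<and> \<one>\<^bsub>G'\<^esub> \<in> W \<and> W \<subseteq> snd ` U" by blast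
  qed
qed

text \<open>The categorical product of two extensions of \<open>G\<close> with arbitrary kernels, for morphisms that are
  the identity on \<open>G\<close>. The Baer sum is its push-out along the addition of the kernel.\<close>

definition fibre_product ::
  "'g topgroup \<Rightarrow> ('h1, 'x1, 'g) extension \<Rightarrow> ('h2, 'x2, 'g) extension
     \<Rightarrow> ('h1 \<times> 'h2, ('x1 \<times> 'x2) \<times> 'g, 'g) extension" where
  "fibre_product G E1 E2 = pullback_ext G (\<lambda>g. (g, g)) (product_ext E1 E2)"

lemma is_extension_fibre_product:
  assumes "is_extension G H1 E1" "is_extension G H2 E2"
  shows "is_extension G (top_DirProd H1 H2) (fibre_product G E1 E2)"
  unfolding fibre_product_def
proof (rule is_extension_pullback_ext[OF is_extension_product_ext[OF assms]])
  show "topological_ab_group G" using assms by (simp add: is_extension_def)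
  show "(\<lambda>g. (g, g)) \<in> top_hom G (top_DirProd G G)"
    by (auto simp: top_hom_iff hom_def intro: continuous_map_pairedI)
qed

lemma continuous_map_fst_fst:
    "continuous_map (subtopology (prod_topology (prod_topology X Y) Z) S) X (\<lambda>z. fst (fst z))"
  and continuous_map_snd_fst:
    "continuous_map (subtopology (prod_topology (prod_topology X Y) Z) S) Y (\<lambda>z. snd (fst z))"
  using continuous_map_compose[OF continuous_map_fst continuous_map_fst, of X Y Z]
    continuous_map_compose[OF continuous_map_fst continuous_map_snd, of X Y Z]
  by (simp_all add: o_def continuous_map_from_subtopology)

lemma fibre_product_fst: "ext_morphism (top_DirProd H1 H2) fst (fibre_product G E1 E2) E1"
  and fibre_product_snd: "ext_morphism (top_DirProd H1 H2) snd (fibre_product G E1 E2) E2"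
proof -
  show "ext_morphism (top_DirProd H1 H2) fst (fibre_product G E1 E2) E1"
    unfolding ext_morphism_def fibre_product_def
    by (rule bexI[of _ "\<lambda>z. fst (fst z)"]) (auto simp: top_hom_iff hom_def intro: continuous_map_fst_fst)
  show "ext_morphism (top_DirProd H1 H2) snd (fibre_product G E1 E2) E2"
    unfolding ext_morphism_def fibre_product_def
    by (rule bexI[of _ "\<lambda>z. snd (fst z)"]) (auto simp: top_hom_iff hom_def intro: continuous_map_snd_fst)
qed

lemma fibre_product_pair:
  assumes F: "is_extension G K F"
    and E1: "ext_morphism K f1 F E1" and E2: "ext_morphism K f2 F E2"
  shows "ext_morphism K (\<lambda>k. (f1 k, f2 k)) F (fibre_product G E1 E2)"
proof -
  interpret F: group_extension G K F by (rule group_extension.intro[OF F])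
  obtain T1 where T1: "T1 \<in> top_hom (total F) (total E1)" "\<forall>k\<in>carrier K. T1 (incl F k) = incl E1 (f1 k)"
    "\<forall>y\<in>carrier (total F). proj E1 (T1 y) = proj F y"
    using E1 by (auto simp: ext_morphism_def)
  obtain T2 where T2: "T2 \<in> top_hom (total F) (total E2)" "\<forall>k\<in>carrier K. T2 (incl F k) = incl E2 (f2 k)"
    "\<forall>y\<in>carrier (total F). proj E2 (T2 y) = proj F y"
    using E2 by (auto simp: ext_morphism_def)
  have "(\<lambda>y. ((T1 y, T2 y), proj F y)) \<in> top_hom (total F) (total (fibre_product G E1 E2))"
    using T1(1,3) T2(1,3) F.proj_continuous
    by (auto simp: fibre_product_def top_hom_iff hom_def continuous_map_in_subtopology F.X.topspace_topo
        intro!: continuous_map_pairedI)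
  then show ?thesis
    unfolding ext_morphism_def
    by (rule bexI[rotated]) (auto simp: fibre_product_def T1(2) T2(2))
qed


text \<open>The subgroup that is divided out is closed: its points \<open>(x, y)\<close> lie over \<open>\<i> H\<close>, which is closed
  as the kernel of the projection, and there \<open>y\<close> depends continuously on \<open>x\<close>.\<close>

lemma pushout_kernel_subgroup:
  assumes E: "is_extension G H E" and H': "topological_ab_group H'" and f: "f \<in> top_hom H H'"
  shows "subgroup (pushout_kernel H H' f E) (top_DirProd (total E) H')"
    and "closedin (topo (top_DirProd (total E) H')) (pushout_kernel H H' f E)"
proof -
  interpret E: group_extension G H E by (rule group_extension.intro[OF E])
  interpret H': topological_ab_group H' by (rule H')
  interpret f: group_hom H H' f by unfold_locales (use f in \<open>simp add: top_hom_iff\<close>)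
  have f_cont: "continuous_map (topo H) (topo H') f" using f by (simp add: top_hom_iff)
  let ?P = "top_DirProd (total E) H'" and ?N = "pushout_kernel H H' f E"
  have P: "topological_ab_group ?P"
    by (rule topological_ab_group_DirProd; unfold_locales)
  then interpret P: topological_ab_group ?P .
  have "(\<lambda>h. (incl E h, inv\<^bsub>H'\<^esub> f h)) \<in> hom H ?P"
    by (auto simp: hom_def H'.inv_mult)
  then interpret d: group_hom H ?P "\<lambda>h. (incl E h, inv\<^bsub>H'\<^esub> f h)" by unfold_locales
  show "subgroup ?N ?P"
    unfolding pushout_kernel_def by (rule d.img_is_subgroup)
  have "openin (topo ?P) (topspace (topo ?P) - ?N)"
  proof (subst openin_subopen, intro ballI)
    fix z assume z: "z \<in> topspace (topo ?P) - ?N"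
    then have zc: "fst z \<in> carrier (total E)" "snd z \<in> carrier H'"
      by (auto simp: E.X.topspace_topo H'.topspace_topo)
    show "\<exists>T. openin (topo ?P) T \<and> z \<in> T \<and> T \<subseteq> topspace (topo ?P) - ?N"
    proof (cases "proj E (fst z) = \<one>\<^bsub>G\<^esub>")
      case False
      have "openin (topo G) (topspace (topo G) - {\<one>\<^bsub>G\<^esub>})"
        using closedin_Hausdorff_singleton[OF E.G.Hausdorff_topo, of "\<one>\<^bsub>G\<^esub>"]
        by (simp add: closedin_def E.G.topspace_topo)
      from openin_continuous_map_preimage[OF E.proj_continuous this]
      have "openin (topo (total E)) {x \<in> carrier (total E). proj E x \<noteq> \<one>\<^bsub>G\<^esub>}" (is "openin _ ?U")
        by (rule back_subst) (auto simp: E.X.topspace_topo E.G.topspace_topo)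
      then have "openin (topo ?P) (?U \<times> topspace (topo H'))"
        by (auto simp: openin_prod_Times_iff)
      moreover have "z \<in> ?U \<times> topspace (topo H')"
        using zc False by (auto simp: H'.topspace_topo mem_Times_iff)
      moreover have "?U \<times> topspace (topo H') \<subseteq> topspace (topo ?P) - ?N"
        by (auto simp: E.X.topspace_topo pushout_kernel_def)
      ultimately show ?thesis by (intro exI conjI)
    next
      case True
      obtain h where "h \<in> carrier H" "fst z = \<one>\<^bsub>total E\<^esub> \<otimes>\<^bsub>total E\<^esub> incl E h"
        by (rule E.fibre[of "fst z" "\<one>\<^bsub>total E\<^esub>"]) (use zc True in auto)
      then have h: "h \<in> carrier H" "fst z = incl E h" by auto
      then have "snd z \<noteq> inv\<^bsub>H'\<^esub> f h"
        using z by (force simp: pushout_kernel_def)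
      then obtain U V where UV: "openin (topo H') U" "openin (topo H') V" "snd z \<in> U"
          "inv\<^bsub>H'\<^esub> f h \<in> V" "disjnt U V"
        using H'.Hausdorff_topo zc(2) h(1) unfolding Hausdorff_space_def H'.topspace_topo
        by (metis H'.inv_closed f.hom_closed)
      have "openin (topo H) {k \<in> carrier H. inv\<^bsub>H'\<^esub> f k \<in> V}" (is "openin _ ?V")
        using openin_continuous_map_preimage[OF H'.continuous_map_inv[OF f_cont] UV(2)]
        by (simp add: E.H.topspace_topo)
      then obtain W where W: "openin (topo (total E)) W" "\<forall>k\<in>carrier H. incl E k \<in> W \<longleftrightarrow> k \<in> ?V"
        by (rule E.incl_open)
      have "openin (topo ?P) (W \<times> U)" using W(1) UV(1) by (auto simp: openin_prod_Times_iff)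
      moreover have "z \<in> W \<times> U" using UV(3,4) W(2) h by (auto simp: mem_Times_iff)
      moreover have "W \<times> U \<subseteq> topspace (topo ?P) - ?N"
        using openin_subset[OF W(1)] openin_subset[OF UV(1)] W(2) UV(5)
        by (auto simp: pushout_kernel_def disjnt_iff)
      ultimately show ?thesis by (intro exI conjI)
    qed
  qed
  moreover have "?N \<subseteq> topspace (topo ?P)"
    by (auto simp: pushout_kernel_def E.X.topspace_topo H'.topspace_topo)
  ultimately show "closedin (topo ?P) ?N" by (simp add: closedin_def)
qed

text \<open>Modulo the graph of \<open>h \<mapsto> (\<i> h, - f h)\<close>, the element \<open>(\<i> h, 0)\<close> becomes \<open>(0, f h)\<close>. So
  \<open>x \<mapsto> (x, 0)\<close> induces a morphism over \<open>f\<close>. The main topological point is that \<open>H'\<close> keeps its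
  topology in the quotient, which holds because \<open>\<i>\<close> is open onto its image and \<open>f\<close> is continuous.\<close>

lemma pushout_ext_properties:
  assumes E: "is_extension G H E" and H': "topological_ab_group H'" and f: "f \<in> top_hom H H'"
  shows is_extension_pushout_ext: "is_extension G H' (pushout_ext H H' f E)"
    and ext_morphism_pushout_ext: "ext_morphism H f E (pushout_ext H H' f E)"
proof -
  interpret E: group_extension G H E by (rule group_extension.intro[OF E])
  interpret H': topological_ab_group H' by (rule H')
  interpret f: group_hom H H' f by unfold_locales (use f in \<open>simp add: top_hom_iff\<close>)
  have f_cont: "continuous_map (topo H) (topo H') f" using f by (simp add: top_hom_iff)
  let ?P = "top_DirProd (total E) H'" and ?N = "pushout_kernel H H' f E" and ?E = "pushout_ext H H' f E"
  have P: "topological_ab_group ?P"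
    by (rule topological_ab_group_DirProd; unfold_locales)
  then interpret P: topological_ab_group ?P .
  note sub = pushout_kernel_subgroup[OF assms]
  let ?Q = "top_quotient_group ?P ?N" and ?q = "\<lambda>z. ?N #>\<^bsub>?P\<^esub> z"
  have Q: "topological_ab_group ?Q" by (rule P.topological_ab_group_quotient[OF sub])
  then interpret Q: topological_ab_group ?Q .
  interpret q: group_hom ?P ?Q ?q by unfold_locales (rule P.coset_hom[OF sub])
  have q_cont: "continuous_map (topo ?P) (topo ?Q) ?q" by (rule P.coset_continuous[OF sub])
  have q_open: "openin (topo ?Q) (?q ` U)" if "openin (topo ?P) U" for U
    using P.coset_open_map[OF sub] that by (simp add: open_map_def)
  have carrierQ: "carrier ?Q = ?q ` carrier ?P" by (rule P.top_quotient_group_simps[OF sub])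
  have q_eq: "?q (x, a) = ?q (y, b) \<longleftrightarrow> (\<exists>h\<in>carrier H. x \<otimes>\<^bsub>total E\<^esub> inv\<^bsub>total E\<^esub> y = incl E h \<and> a \<otimes>\<^bsub>H'\<^esub> inv\<^bsub>H'\<^esub> b = inv\<^bsub>H'\<^esub> f h)"
    if "x \<in> carrier (total E)" "y \<in> carrier (total E)" "a \<in> carrier H'" "b \<in> carrier H'" for x y a b
    using that by (subst P.coset_eq_iff[OF sub]) (auto simp: pushout_kernel_def)
  have simps: "total ?E = ?Q" "incl ?E = (\<lambda>h. ?q (\<one>\<^bsub>total E\<^esub>, h))"
    "proj ?E = (\<lambda>A. the_elem ((\<lambda>(x, h'). proj E x) ` A))"
    by (simp_all add: pushout_ext_def Let_def)
  have proj_q: "proj ?E (?q z) = proj E (fst z)" if z: "z \<in> carrier ?P" for z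
  proof -
    have "(\<lambda>(x, h'). proj E x) ` (?q z) = {proj E (fst z)}"
      using z P.rcos_self[OF z sub(1)]
      by (auto simp: r_coset_def pushout_kernel_def image_iff intro: bexI[of _ "\<one>\<^bsub>H\<^esub>"])
    then show ?thesis by (simp add: simps)
  qed
  have i_hom: "incl ?E \<in> hom H' ?Q"
  proof (rule homI)
    fix a b assume ab: "a \<in> carrier H'" "b \<in> carrier H'"
    show "incl ?E a \<in> carrier ?Q" using ab by (simp add: simps)
    show "incl ?E (a \<otimes>\<^bsub>H'\<^esub> b) = incl ?E a \<otimes>\<^bsub>?Q\<^esub> incl ?E b"
      using ab q.hom_mult[of "(\<one>\<^bsub>total E\<^esub>, a)" "(\<one>\<^bsub>total E\<^esub>, b)"] by (simp add: simps)
  qed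
  have i_cont: "continuous_map (topo H') (topo ?Q) (incl ?E)"
  proof -
    have "continuous_map (topo H') (topo ?P) (\<lambda>h. (\<one>\<^bsub>total E\<^esub>, h))"
      by (auto simp: E.X.topspace_topo intro!: continuous_map_pairedI)
    from continuous_map_compose[OF this q_cont] show ?thesis by (simp add: o_def simps)
  qed
  have p_hom: "proj ?E \<in> hom ?Q G"
  proof (rule homI)
    fix A B assume "A \<in> carrier ?Q" "B \<in> carrier ?Q"
    then obtain a b where ab: "a \<in> carrier ?P" "A = ?q a" "b \<in> carrier ?P" "B = ?q b"
      unfolding carrierQ by (elim imageE)
    show "proj ?E A \<in> carrier G" using ab(1) by (auto simp: ab(2) proj_q)
    have "proj ?E (A \<otimes>\<^bsub>?Q\<^esub> B) = proj E (fst (a \<otimes>\<^bsub>?P\<^esub> b))"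
      using ab proj_q[of "a \<otimes>\<^bsub>?P\<^esub> b"] P.m_closed[OF ab(1,3)] q.hom_mult[OF ab(1,3)] by metis
    then show "proj ?E (A \<otimes>\<^bsub>?Q\<^esub> B) = proj ?E A \<otimes>\<^bsub>G\<^esub> proj ?E B"
      using ab by (auto simp: proj_q)
  qed
  have p_cont: "continuous_map (topo ?Q) (topo G) (proj ?E)"
  proof (rule continuous_compose_quotient_map[OF P.coset_quotient_map[OF sub]])
    have "continuous_map (topo ?P) (topo G) (proj E \<circ> fst)"
      using continuous_map_compose[OF continuous_map_fst E.proj_continuous] by simp
    then show "continuous_map (topo ?P) (topo G) (proj ?E \<circ> ?q)"
      by (rule continuous_map_eq) (auto simp: proj_q E.X.topspace_topo H'.topspace_topo)
  qed
  show "is_extension G H' ?E"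
  proof (rule is_extensionI, unfold simps(1))
    show "topological_ab_group G" "topological_ab_group H'" "topological_ab_group ?Q" by unfold_locales
    fix h assume h: "h \<in> carrier H'"
    show "proj ?E (incl ?E h) = \<one>\<^bsub>G\<^esub>"
      using h proj_q[of "(\<one>\<^bsub>total E\<^esub>, h)"] by (simp add: simps(2))
    assume "incl ?E h = \<one>\<^bsub>?Q\<^esub>"
    then have "?q (\<one>\<^bsub>total E\<^esub>, h) = ?q (\<one>\<^bsub>total E\<^esub>, \<one>\<^bsub>H'\<^esub>)"
      using q.hom_one by (simp add: simps(2))
    then obtain k where k: "k \<in> carrier H" "incl E k = \<one>\<^bsub>total E\<^esub>" "h = inv\<^bsub>H'\<^esub> f k"
      using h by (subst (asm) q_eq) auto
    then have "k = \<one>\<^bsub>H\<^esub>" using E.incl_inj by (simp add: E.incl.inj_on_one_iff)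
    then show "h = \<one>\<^bsub>H'\<^esub>" using k(3) by simp
  next
    fix A assume A: "A \<in> carrier ?Q" "proj ?E A = \<one>\<^bsub>G\<^esub>"
    then obtain z where z: "z \<in> carrier ?P" "A = ?q z" unfolding carrierQ by (elim imageE)
    then have "proj E (fst z) = \<one>\<^bsub>G\<^esub>" using A(2) proj_q by simp
    obtain h where "h \<in> carrier H" "fst z = \<one>\<^bsub>total E\<^esub> \<otimes>\<^bsub>total E\<^esub> incl E h"
      by (rule E.fibre[of "fst z" "\<one>\<^bsub>total E\<^esub>"]) (use z \<open>proj E (fst z) = _\<close> in auto)
    then have h: "h \<in> carrier H" "fst z = incl E h" by auto
    have zc: "snd z \<in> carrier H'" using z by auto
    have "A = ?q (incl E h, snd z)" by (simp only: z(2) flip: h(2)) simp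
    also have "\<dots> = ?q (\<one>\<^bsub>total E\<^esub>, snd z \<otimes>\<^bsub>H'\<^esub> f h)"
      using h(1) zc by (subst q_eq) (auto simp: H'.inv_mult H'.m_assoc[symmetric] intro!: bexI[of _ h])
    also have "\<dots> = incl ?E (snd z \<otimes>\<^bsub>H'\<^esub> f h)" by (simp only: simps(2))
    finally show "\<exists>h\<in>carrier H'. A = incl ?E h"
      using h(1) zc by (intro bexI[of _ "snd z \<otimes>\<^bsub>H'\<^esub> f h"]) simp_all
  next
    fix g assume "g \<in> carrier G"
    then obtain x where x: "x \<in> carrier (total E)" "proj E x = g" by (rule E.lift)
    then have "proj ?E (?q (x, \<one>\<^bsub>H'\<^esub>)) = g" "?q (x, \<one>\<^bsub>H'\<^esub>) \<in> carrier ?Q"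
      using proj_q[of "(x, \<one>\<^bsub>H'\<^esub>)"] by simp_all
    then show "\<exists>A\<in>carrier ?Q. proj ?E A = g" by (rule rev_bexI[rotated])
  next
    fix V assume V: "openin (topo H') V" "\<one>\<^bsub>H'\<^esub> \<in> V"
    \<comment> \<open>If the coset of \<open>(0, v)\<close> is that of a small pair \<open>(\<i> k, b)\<close>, then \<open>v = b + f k\<close> is small.\<close>
    then obtain B where B: "openin (topo H') B" "\<one>\<^bsub>H'\<^esub> \<in> B"
      "\<forall>x\<in>B. \<forall>y\<in>B. x \<otimes>\<^bsub>H'\<^esub> y \<in> V"
      by (rule H'.one_nbhd_mult)
    have "openin (topo H) {k \<in> carrier H. f k \<in> B}" (is "openin _ ?K")
      using openin_continuous_map_preimage[OF f_cont B(1)] by (simp add: E.H.topspace_topo)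
    then obtain A where A: "openin (topo (total E)) A" "\<forall>k\<in>carrier H. incl E k \<in> A \<longleftrightarrow> k \<in> ?K"
      by (rule E.incl_open)
    have "\<one>\<^bsub>total E\<^esub> \<in> A"
      using A(2) B(2) E.incl.hom_one E.H.one_closed f.hom_one by (metis (mono_tags, lifting) mem_Collect_eq)
    then have "(\<one>\<^bsub>total E\<^esub>, \<one>\<^bsub>H'\<^esub>) \<in> A \<times> B" using B(2) by simp
    then have "\<one>\<^bsub>?Q\<^esub> \<in> ?q ` (A \<times> B)"
      using q.hom_one by (metis top_DirProd_simps(3) image_eqI)
    moreover have "h \<in> V" if h: "h \<in> carrier H'" "incl ?E h \<in> ?q ` (A \<times> B)" for h
    proof -
      obtain a b where ab: "a \<in> A" "b \<in> B" "?q (a, b) = ?q (\<one>\<^bsub>total E\<^esub>, h)"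
        using h(2) by (auto simp: simps(2))
      have abc: "a \<in> carrier (total E)" "b \<in> carrier H'"
        using ab(1,2) E.X.openin_carrier[OF A(1)] H'.openin_carrier[OF B(1)] by auto
      then obtain k where k: "k \<in> carrier H" "a = incl E k" "b \<otimes>\<^bsub>H'\<^esub> inv\<^bsub>H'\<^esub> h = inv\<^bsub>H'\<^esub> f k"
        using ab(3) h(1) by (subst (asm) q_eq) auto
      have "h = b \<otimes>\<^bsub>H'\<^esub> inv\<^bsub>H'\<^esub> (b \<otimes>\<^bsub>H'\<^esub> inv\<^bsub>H'\<^esub> h)"
        using abc h(1) by (simp add: H'.inv_mult H'.m_assoc[symmetric])
      then have "h = b \<otimes>\<^bsub>H'\<^esub> f k" using k by simp
      moreover have "f k \<in> B" using A(2) k(1,2) ab(1) by simp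
      ultimately show ?thesis using B(3) ab(2) by simp
    qed
    ultimately show "\<exists>W. openin (topo ?Q) W \<and> \<one>\<^bsub>?Q\<^esub> \<in> W \<and> (\<forall>h\<in>carrier H'. incl ?E h \<in> W \<longrightarrow> h \<in> V)"
      using q_open[of "A \<times> B"] A(1) B(1) by (intro exI[of _ "?q ` (A \<times> B)"]) (auto simp: openin_prod_Times_iff)
  next
    fix U assume U: "openin (topo ?Q) U" "\<one>\<^bsub>?Q\<^esub> \<in> U"
    let ?U = "{z \<in> carrier ?P. ?q z \<in> U}"
    have "openin (topo ?P) ?U"
      using openin_continuous_map_preimage[OF q_cont U(1)]
      by (simp add: P.topspace_topo del: top_DirProd_simps)
    moreover have "(\<one>\<^bsub>total E\<^esub>, \<one>\<^bsub>H'\<^esub>) \<in> ?U" using U(2) q.hom_one by simp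
    ultimately obtain A B where AB: "openin (topo (total E)) A" "openin (topo H') B"
      "\<one>\<^bsub>total E\<^esub> \<in> A" "\<one>\<^bsub>H'\<^esub> \<in> B" "A \<times> B \<subseteq> ?U"
      unfolding top_DirProd_simps by (rule openin_prod_box)
    have "proj E ` A \<subseteq> proj ?E ` U"
    proof
      fix g assume "g \<in> proj E ` A"
      then obtain x where x: "x \<in> A" "g = proj E x" by blast
      then have "(x, \<one>\<^bsub>H'\<^esub>) \<in> ?U" using AB(4,5) by auto
      then show "g \<in> proj ?E ` U"
        using proj_q[of "(x, \<one>\<^bsub>H'\<^esub>)"] x(2) by (intro image_eqI[of _ _ "?q (x, \<one>\<^bsub>H'\<^esub>)"]) auto
    qed
    moreover have "\<one>\<^bsub>G\<^esub> \<in> proj E ` A" using AB(3) by (metis image_eqI E.proj.hom_one)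
    ultimately show "\<exists>W. openin (topo G) W \<and> \<one>\<^bsub>G\<^esub> \<in> W \<and> W \<subseteq> proj ?E ` U"
      using E.proj_open[OF AB(1)] by blast
  qed (fact i_hom i_cont p_hom p_cont)+
  have "(\<lambda>x. ?q (x, \<one>\<^bsub>H'\<^esub>)) \<in> top_hom (total E) ?Q"
  proof -
    have "(\<lambda>x. (x, \<one>\<^bsub>H'\<^esub>)) \<in> top_hom (total E) ?P"
      by (auto simp: top_hom_iff hom_def H'.topspace_topo intro!: continuous_map_pairedI)
    moreover have "?q \<in> top_hom ?P ?Q" by (simp only: top_hom_iff q.homh q_cont simp_thms)
    ultimately show ?thesis by (rule top_hom_compose)
  qed
  moreover have "?q (incl E h, \<one>\<^bsub>H'\<^esub>) = incl ?E (f h)" if "h \<in> carrier H" for h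
    using that by (auto simp: simps(2) q_eq)
  moreover have "proj ?E (?q (x, \<one>\<^bsub>H'\<^esub>)) = proj E x" if "x \<in> carrier (total E)" for x
    using that proj_q[of "(x, \<one>\<^bsub>H'\<^esub>)"] by simp
  ultimately show "ext_morphism H f E ?E"
    unfolding ext_morphism_def simps(1) by (intro bexI[of _ "\<lambda>x. ?q (x, \<one>\<^bsub>H'\<^esub>)"]) auto
qed

lemma trivial_ext_simps [simp]:
  "total (trivial_ext G H) = top_DirProd H G"
  "incl (trivial_ext G H) = (\<lambda>h. (h, \<one>\<^bsub>G\<^esub>))"
  "proj (trivial_ext G H) = snd"
  by (simp_all add: trivial_ext_def)

lemma is_extension_trivial_ext:
  assumes G: "topological_ab_group G" and H: "topological_ab_group H"
  shows "is_extension G H (trivial_ext G H)"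
proof -
  interpret G: topological_ab_group G by (rule G)
  interpret H: topological_ab_group H by (rule H)
  show ?thesis
  proof (rule is_extensionI[OF G H], unfold trivial_ext_simps)
    show "topological_ab_group (top_DirProd H G)" by (rule topological_ab_group_DirProd[OF H G])
    fix V assume "openin (topo H) V" "\<one>\<^bsub>H\<^esub> \<in> V"
    then show "\<exists>W. openin (topo (top_DirProd H G)) W \<and> \<one>\<^bsub>top_DirProd H G\<^esub> \<in> W \<and>
        (\<forall>h\<in>carrier H. (h, \<one>\<^bsub>G\<^esub>) \<in> W \<longrightarrow> h \<in> V)"
      using openin_topspace[of "topo G"]
      by (intro exI[of _ "V \<times> carrier G"]) (auto simp: openin_prod_Times_iff G.topspace_topo)
  next
    fix U assume U: "openin (topo (top_DirProd H G)) U" "\<one>\<^bsub>top_DirProd H G\<^esub> \<in> U"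
    then have "openin (topo G) (snd ` U)"
      using open_map_snd by (auto simp: open_map_def)
    then show "\<exists>W. openin (topo G) W \<and> \<one>\<^bsub>G\<^esub> \<in> W \<and> W \<subseteq> snd ` U"
      using U(2) by (intro exI[of _ "snd ` U"]) force
  qed (auto simp: hom_def G.topspace_topo H.topspace_topo continuous_map_snd
      intro!: continuous_map_pairedI)
qed

lemma ext_morphism_trivial_ext:
  assumes "f \<in> top_hom H K"
    and "topological_ab_group G" "topological_ab_group H" "topological_ab_group K"
  shows "ext_morphism H f (trivial_ext G H) (trivial_ext G K)"
proof -
  have "(\<lambda>z. (f (fst z), snd z)) \<in> top_hom (top_DirProd H G) (top_DirProd K G)"
    using assms(1) continuous_map_map_prod[of "topo H" "topo K" f "topo G" "topo G" "\<lambda>x. x"]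
    by (auto simp: top_hom_iff hom_def map_prod_def case_prod_unfold)
  then show ?thesis
    unfolding ext_morphism_def by (intro bexI[of _ "\<lambda>z. (f (fst z), snd z)"]) auto
qed

text \<open>The trivial extension is the push-out of every extension along the zero map, hence the zero
  element of the group of extensions.\<close>

lemma ext_morphism_zero:
  assumes F: "is_extension G K F" and H: "topological_ab_group H"
  shows "ext_morphism K (\<lambda>k. \<one>\<^bsub>H\<^esub>) F (trivial_ext G H)"
proof -
  interpret F: group_extension G K F by (rule group_extension.intro[OF F])
  interpret H: topological_ab_group H by (rule H)
  have "(\<lambda>y. (\<one>\<^bsub>H\<^esub>, proj F y)) \<in> top_hom (total F) (top_DirProd H G)"
    by (auto simp: top_hom_iff hom_def F.X.topspace_topo H.topspace_topo
        intro!: continuous_map_pairedI F.proj_continuous)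
  then show ?thesis
    unfolding ext_morphism_def by (intro bexI[of _ "\<lambda>y. (\<one>\<^bsub>H\<^esub>, proj F y)"]) auto
qed

section \<open>Baer sums\<close>

lemma baer_sum_eq:
  "baer_sum G H E1 E2 =
     pushout_ext (top_DirProd H H) H (\<lambda>z. fst z \<otimes>\<^bsub>H\<^esub> snd z) (fibre_product G E1 E2)"
  by (simp add: baer_sum_def fibre_product_def case_prod_unfold)

lemma (in topological_ab_group) mult_top_hom:
  "(\<lambda>z. fst z \<otimes> snd z) \<in> top_hom (top_DirProd G G) G"
  using continuous_map_mult_pair by (auto simp: top_hom_iff hom_def m_ac)

lemma (in topological_ab_group) inv_top_hom: "m_inv G \<in> top_hom G G"
  using continuous_inv by (auto simp: top_hom_iff hom_def inv_mult)

lemma is_extension_baer_sum: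
  assumes "is_extension G H E1" "is_extension G H E2"
  shows "is_extension G H (baer_sum G H E1 E2)"
proof -
  interpret E1: group_extension G H E1 by (rule group_extension.intro[OF assms(1)])
  show ?thesis
    unfolding baer_sum_eq
    by (rule is_extension_pushout_ext[OF is_extension_fibre_product[OF assms] _ E1.H.mult_top_hom])
      unfold_locales
qed

text \<open>Morphisms from a common source add up to a morphism to the Baer sum. Two extensions that receive
  morphisms over the same map of kernels are equivalent, so every law of the Baer sum reduces to an
  equation between maps of kernels, once a suitable common source is chosen.\<close>

lemma ext_morphism_baer_sum:
  assumes F: "is_extension G K F" and E1: "is_extension G H E1" and E2: "is_extension G H E2"
    and f1: "ext_morphism K f1 F E1" "f1 \<in> carrier K \<rightarrow> carrier H"
    and f2: "ext_morphism K f2 F E2" "f2 \<in> carrier K \<rightarrow> carrier H"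
  shows "ext_morphism K (\<lambda>k. f1 k \<otimes>\<^bsub>H\<^esub> f2 k) F (baer_sum G H E1 E2)"
proof -
  interpret E1: group_extension G H E1 by (rule group_extension.intro[OF E1])
  have H: "topological_ab_group H" by unfold_locales
  have "ext_morphism (top_DirProd H H) (\<lambda>z. fst z \<otimes>\<^bsub>H\<^esub> snd z) (fibre_product G E1 E2)
      (baer_sum G H E1 E2)"
    unfolding baer_sum_eq
    by (rule ext_morphism_pushout_ext[OF is_extension_fibre_product[OF E1 E2] H E1.H.mult_top_hom])
  from ext_morphism_trans[OF fibre_product_pair[OF F f1(1) f2(1)] this]
  show ?thesis using f1(2) f2(2) by auto
qed

lemma baer_sum_cong:
  assumes "ext_equiv G H E1 E1'" "ext_equiv G H E2 E2'"
  shows "ext_equiv G H (baer_sum G H E1 E2) (baer_sum G H E1' E2')"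
proof -
  note E = assms[unfolded ext_equiv_iff]
  let ?F = "fibre_product G E1 E2"
  have F: "is_extension G (top_DirProd H H) ?F"
    using E by (intro is_extension_fibre_product) auto
  have m: "ext_morphism H (\<lambda>h. h) E1 E1'" "ext_morphism H (\<lambda>h. h) E2 E2'" using E by auto
  have "ext_morphism (top_DirProd H H) fst ?F E1'"
    by (rule ext_morphism_trans[OF fibre_product_fst m(1)]) auto
  moreover have "ext_morphism (top_DirProd H H) snd ?F E2'"
    by (rule ext_morphism_trans[OF fibre_product_snd m(2)]) auto
  ultimately have "ext_morphism (top_DirProd H H) (\<lambda>k. fst k \<otimes>\<^bsub>H\<^esub> snd k) ?F (baer_sum G H E1' E2')"
    using E by (intro ext_morphism_baer_sum[OF F]) auto
  moreover have "ext_morphism (top_DirProd H H) (\<lambda>k. fst k \<otimes>\<^bsub>H\<^esub> snd k) ?F (baer_sum G H E1 E2)"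
    using E by (intro ext_morphism_baer_sum[OF F] fibre_product_fst fibre_product_snd) auto
  moreover have "(\<lambda>k. fst k \<otimes>\<^bsub>H\<^esub> snd k) \<in> carrier (top_DirProd H H) \<rightarrow> carrier H"
    using topological_ab_group.mult_top_hom[of H] E
    by (auto simp: is_extension_def top_hom_iff hom_def)
  ultimately show ?thesis
    using E by (intro ext_morphism_determines_target[OF F]) (auto intro: is_extension_baer_sum)
qed

lemma baer_sum_commute:
  assumes E1: "is_extension G H E1" and E2: "is_extension G H E2"
  shows "ext_equiv G H (baer_sum G H E1 E2) (baer_sum G H E2 E1)"
proof -
  interpret E1: group_extension G H E1 by (rule group_extension.intro[OF E1])
  let ?F = "fibre_product G E1 E2" and ?K = "top_DirProd H H"
  note F = is_extension_fibre_product[OF E1 E2]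
  have "ext_morphism ?K (\<lambda>k. fst k \<otimes>\<^bsub>H\<^esub> snd k) ?F (baer_sum G H E1 E2)"
    by (intro ext_morphism_baer_sum[OF F E1 E2] fibre_product_fst fibre_product_snd) auto
  moreover have "ext_morphism ?K (\<lambda>k. snd k \<otimes>\<^bsub>H\<^esub> fst k) ?F (baer_sum G H E2 E1)"
    by (intro ext_morphism_baer_sum[OF F E2 E1] fibre_product_fst fibre_product_snd) auto
  then have "ext_morphism ?K (\<lambda>k. fst k \<otimes>\<^bsub>H\<^esub> snd k) ?F (baer_sum G H E2 E1)"
    by (rule ext_morphism_cong) (auto intro: E1.H.m_comm)
  ultimately show ?thesis
    by (intro ext_morphism_determines_target[OF F] is_extension_baer_sum E1 E2) auto
qed

text \<open>Both ways of bracketing receive a morphism from the threefold fibre product over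
  \<open>((a, b), c) \<mapsto> a + b + c\<close>.\<close>

lemma baer_sum_assoc:
  assumes E1: "is_extension G H E1" and E2: "is_extension G H E2" and E3: "is_extension G H E3"
  shows "ext_equiv G H (baer_sum G H (baer_sum G H E1 E2) E3) (baer_sum G H E1 (baer_sum G H E2 E3))"
proof -
  interpret E1: group_extension G H E1 by (rule group_extension.intro[OF E1])
  let ?F = "fibre_product G (fibre_product G E1 E2) E3"
  let ?K = "top_DirProd (top_DirProd H H) H"
  note E12 = is_extension_fibre_product[OF E1 E2]
  note F = is_extension_fibre_product[OF E12 E3]
  have 1: "ext_morphism ?K (\<lambda>k. fst (fst k)) ?F E1"
    by (rule ext_morphism_trans[OF fibre_product_fst fibre_product_fst]) auto
  have 2: "ext_morphism ?K (\<lambda>k. snd (fst k)) ?F E2"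
    by (rule ext_morphism_trans[OF fibre_product_fst fibre_product_snd]) auto
  note 3 = fibre_product_snd[of "top_DirProd H H" H G "fibre_product G E1 E2" E3]
  have "ext_morphism ?K (\<lambda>k. (fst (fst k) \<otimes>\<^bsub>H\<^esub> snd (fst k)) \<otimes>\<^bsub>H\<^esub> snd k) ?F
      (baer_sum G H (baer_sum G H E1 E2) E3)"
    by (intro ext_morphism_baer_sum[OF F] is_extension_baer_sum E1 E2 E3 1 2 3) auto
  moreover have "ext_morphism ?K (\<lambda>k. fst (fst k) \<otimes>\<^bsub>H\<^esub> (snd (fst k) \<otimes>\<^bsub>H\<^esub> snd k)) ?F
      (baer_sum G H E1 (baer_sum G H E2 E3))"
    by (intro ext_morphism_baer_sum[OF F] is_extension_baer_sum E1 E2 E3 1 2 3) auto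
  then have "ext_morphism ?K (\<lambda>k. (fst (fst k) \<otimes>\<^bsub>H\<^esub> snd (fst k)) \<otimes>\<^bsub>H\<^esub> snd k) ?F
      (baer_sum G H E1 (baer_sum G H E2 E3))"
    by (rule ext_morphism_cong) (auto simp: E1.H.m_assoc)
  ultimately show ?thesis
    by (intro ext_morphism_determines_target[OF F] is_extension_baer_sum E1 E2 E3) auto
qed

lemma baer_sum_trivial_ext:
  assumes E: "is_extension G H E"
  shows "ext_equiv G H (baer_sum G H (trivial_ext G H) E) E"
proof -
  interpret E: group_extension G H E by (rule group_extension.intro[OF E])
  have H: "topological_ab_group H" and G: "topological_ab_group G" by unfold_locales
  note T = is_extension_trivial_ext[OF G H]
  have "ext_morphism H (\<lambda>h. \<one>\<^bsub>H\<^esub> \<otimes>\<^bsub>H\<^esub> h) E (baer_sum G H (trivial_ext G H) E)"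
    by (rule ext_morphism_baer_sum[OF E T E ext_morphism_zero[OF E H] _ ext_morphism_refl]) auto
  then have "ext_morphism H (\<lambda>h. h) E (baer_sum G H (trivial_ext G H) E)"
    by (rule ext_morphism_cong) auto
  then have "ext_equiv G H E (baer_sum G H (trivial_ext G H) E)"
    unfolding ext_equiv_iff by (intro conjI E is_extension_baer_sum[OF T E])
  then show ?thesis by (rule ext_equiv_sym)
qed

text \<open>The negative of an extension is its push-out along negation: \<open>E\<close> itself is a common source
  for both summands, and the sum of the maps of kernels is \<open>- h + h = 0\<close>.\<close>

lemma baer_sum_inverse:
  assumes E: "is_extension G H E"
  shows "ext_equiv G H (baer_sum G H (pushout_ext H H (m_inv H) E) E) (trivial_ext G H)"
proof -
  interpret E: group_extension G H E by (rule group_extension.intro[OF E])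
  have H: "topological_ab_group H" and G: "topological_ab_group G" by unfold_locales
  note T = is_extension_trivial_ext[OF G H]
  note N = is_extension_pushout_ext[OF E H E.H.inv_top_hom]
  have "ext_morphism H (\<lambda>h. inv\<^bsub>H\<^esub> h \<otimes>\<^bsub>H\<^esub> h) E (baer_sum G H (pushout_ext H H (m_inv H) E) E)"
    by (rule ext_morphism_baer_sum[OF E N E ext_morphism_pushout_ext[OF E H E.H.inv_top_hom]
          _ ext_morphism_refl]) auto
  then have "ext_morphism H (\<lambda>h. \<one>\<^bsub>H\<^esub>) E (baer_sum G H (pushout_ext H H (m_inv H) E) E)"
    by (rule ext_morphism_cong) auto
  then show ?thesis
    by (intro ext_morphism_determines_target[OF E _ T _ _ ext_morphism_zero[OF E H]]
        is_extension_baer_sum N E) auto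
qed

section \<open>The group of extensions\<close>

lemma ext_class_eq_iff:
  assumes "is_extension G H E" "is_extension G H E'"
  shows "ext_class G H E = ext_class G H E' \<longleftrightarrow> ext_equiv G H E E'"
proof
  assume eq: "ext_class G H E = ext_class G H E'"
  obtain D where "D \<in> ext_class G H E" using ext_class_nonempty[OF assms(1)] by auto
  then have "ext_equiv G H E D" "ext_equiv G H E' D" using eq by (auto simp: ext_class_def)
  then show "ext_equiv G H E E'" by (metis ext_equiv_sym ext_equiv_trans)
next
  assume "ext_equiv G H E E'"
  then show "ext_class G H E = ext_class G H E'"
    unfolding ext_class_def by (metis ext_equiv_sym ext_equiv_trans)
qed

text \<open>Constructions such as the Baer sum change the type of the total group. This lemma leads back to
  the type over which equivalence classes are formed.\<close>

lemma ext_class_representative: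
  fixes E :: "('h, 'x, 'g) extension"
  assumes "is_extension G H E"
  obtains E' :: "('h, 'h \<times> 'g, 'g) extension"
  where "is_extension G H E'" "ext_equiv G H E E'" "ext_class G H E' = ext_class G H E"
proof -
  obtain E' where "E' \<in> ext_class G H E" using ext_class_nonempty[OF assms] by auto
  then have "ext_equiv G H E E'" by (simp add: ext_class_def)
  then show thesis
    using that ext_class_eq_iff[of G H E E'] by (auto simp: ext_equiv_iff)
qed

lemma ext_class_in_Ext:
  fixes E :: "('h, 'x, 'g) extension"
  assumes "is_extension G H E"
  shows "ext_class G H E \<in> carrier (Ext G H)"
proof -
  obtain E' :: "('h, 'h \<times> 'g, 'g) extension"
    where "is_extension G H E'" "ext_equiv G H E E'" "ext_class G H E' = ext_class G H E"
    by (rule ext_class_representative[OF assms])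
  then show ?thesis by (auto simp: Ext_def)
qed

lemma Ext_carrierE:
  fixes G :: "'g topgroup" and H :: "'h topgroup"
  assumes "A \<in> carrier (Ext G H)"
  obtains E :: "('h, 'h \<times> 'g, 'g) extension" where "is_extension G H E" "A = ext_class G H E"
  using assms by (auto simp: Ext_def)

lemma one_Ext: "\<one>\<^bsub>Ext G H\<^esub> = ext_class G H (trivial_ext G H)"
  by (simp add: Ext_def)

lemma mult_Ext:
  assumes E1: "is_extension G H E1" and E2: "is_extension G H E2"
  shows "ext_class G H E1 \<otimes>\<^bsub>Ext G H\<^esub> ext_class G H E2 = ext_class G H (baer_sum G H E1 E2)"
proof -
  have "ext_class G H (baer_sum G H E1' E2') = ext_class G H (baer_sum G H E1 E2)"
    if "E1' \<in> ext_class G H E1" "E2' \<in> ext_class G H E2" for E1' E2'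
  proof -
    have eqv: "ext_equiv G H E1' E1" "ext_equiv G H E2' E2"
      using that by (auto simp: ext_class_def intro: ext_equiv_sym)
    from baer_sum_cong[OF this] show ?thesis
      using eqv by (subst ext_class_eq_iff) (auto simp: ext_equiv_iff)
  qed
  then have "(\<Union>E1'\<in>ext_class G H E1. \<Union>E2'\<in>ext_class G H E2. ext_class G H (baer_sum G H E1' E2'))
      = (\<Union>E1'\<in>ext_class G H E1. \<Union>E2'\<in>ext_class G H E2. ext_class G H (baer_sum G H E1 E2))"
    by (intro SUP_cong refl) auto
  also have "\<dots> = ext_class G H (baer_sum G H E1 E2)"
    using ext_class_nonempty[OF E1] ext_class_nonempty[OF E2] by simp
  finally show ?thesis by (simp add: Ext_def)
qed

theorem comm_group_Ext:
  fixes G :: "'g topgroup" and H :: "'h topgroup"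
  assumes G: "topological_ab_group G" and H: "topological_ab_group H"
  shows "comm_group (Ext G H)"
proof (rule comm_groupI)
  note T = is_extension_trivial_ext[OF G H]
  note class_eq = ext_class_eq_iff[THEN iffD2, rotated 2]
  show "\<one>\<^bsub>Ext G H\<^esub> \<in> carrier (Ext G H)"
    by (simp add: one_Ext ext_class_in_Ext T)
  fix A assume "A \<in> carrier (Ext G H)"
  then obtain E1 :: "('h, 'h \<times> 'g, 'g) extension"
    where E1: "is_extension G H E1" "A = ext_class G H E1" by (rule Ext_carrierE)
  show "\<one>\<^bsub>Ext G H\<^esub> \<otimes>\<^bsub>Ext G H\<^esub> A = A"
    unfolding E1(2) one_Ext mult_Ext[OF T E1(1)]
    by (rule class_eq[OF baer_sum_trivial_ext[OF E1(1)]]) (intro is_extension_baer_sum T E1)+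
  define N where "N = pushout_ext H H (m_inv H) E1"
  have N: "is_extension G H N"
    unfolding N_def by (rule is_extension_pushout_ext[OF E1(1) H topological_ab_group.inv_top_hom[OF H]])
  have "ext_class G H N \<otimes>\<^bsub>Ext G H\<^esub> A = \<one>\<^bsub>Ext G H\<^esub>"
    unfolding E1(2) one_Ext mult_Ext[OF N E1(1)] unfolding N_def
    by (rule class_eq[OF baer_sum_inverse[OF E1(1)]])
      (intro is_extension_baer_sum T E1 N[unfolded N_def])+
  then show "\<exists>B\<in>carrier (Ext G H). B \<otimes>\<^bsub>Ext G H\<^esub> A = \<one>\<^bsub>Ext G H\<^esub>"
    using ext_class_in_Ext[OF N] by (rule bexI)
  fix B assume "B \<in> carrier (Ext G H)"
  then obtain E2 :: "('h, 'h \<times> 'g, 'g) extension"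
    where E2: "is_extension G H E2" "B = ext_class G H E2" by (rule Ext_carrierE)
  note E12 = is_extension_baer_sum[OF E1(1) E2(1)]
  show "A \<otimes>\<^bsub>Ext G H\<^esub> B \<in> carrier (Ext G H)"
    unfolding E1(2) E2(2) mult_Ext[OF E1(1) E2(1)] by (rule ext_class_in_Ext[OF E12])
  show "A \<otimes>\<^bsub>Ext G H\<^esub> B = B \<otimes>\<^bsub>Ext G H\<^esub> A"
    unfolding E1(2) E2(2) mult_Ext[OF E1(1) E2(1)] mult_Ext[OF E2(1) E1(1)]
    by (rule class_eq[OF baer_sum_commute[OF E1(1) E2(1)] E12 is_extension_baer_sum[OF E2(1) E1(1)]])
  fix C assume "C \<in> carrier (Ext G H)"
  then obtain E3 :: "('h, 'h \<times> 'g, 'g) extension"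
    where E3: "is_extension G H E3" "C = ext_class G H E3" by (rule Ext_carrierE)
  note E23 = is_extension_baer_sum[OF E2(1) E3(1)]
  show "A \<otimes>\<^bsub>Ext G H\<^esub> B \<otimes>\<^bsub>Ext G H\<^esub> C = A \<otimes>\<^bsub>Ext G H\<^esub> (B \<otimes>\<^bsub>Ext G H\<^esub> C)"
    unfolding E1(2) E2(2) E3(2) mult_Ext[OF E1(1) E2(1)] mult_Ext[OF E2(1) E3(1)]
      mult_Ext[OF E12 E3(1)] mult_Ext[OF E1(1) E23]
    by (rule class_eq[OF baer_sum_assoc[OF E1(1) E2(1) E3(1)]
          is_extension_baer_sum[OF E12 E3(1)] is_extension_baer_sum[OF E1(1) E23]])
qed

section \<open>Divisibility and torsion\<close>

text \<open>The diagonal maps \<open>E\<close> to the \<open>n\<close>-fold Baer sum of \<open>E\<close>, and on kernels this is multiplication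
  by \<open>n\<close>. In other words, multiplication by \<open>n\<close> on the group of extensions is the push-out along
  multiplication by \<open>n\<close> on the kernel.\<close>

lemma Ext_nat_pow:
  fixes G :: "'g topgroup" and H :: "'h topgroup" and E :: "('h, 'h \<times> 'g, 'g) extension"
  assumes E: "is_extension G H E"
  shows "\<exists>E' :: ('h, 'h \<times> 'g, 'g) extension. is_extension G H E' \<and>
     ext_class G H E [^]\<^bsub>Ext G H\<^esub> (n::nat) = ext_class G H E' \<and>
     ext_morphism H (\<lambda>h. h [^]\<^bsub>H\<^esub> n) E E'"
proof (induction n)
  case 0
  interpret E: group_extension G H E by (rule group_extension.intro[OF E])
  have H: "topological_ab_group H" and G: "topological_ab_group G" by unfold_locales
  show ?case
    using is_extension_trivial_ext[OF G H] ext_morphism_zero[OF E H]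
    by (intro exI[of _ "trivial_ext G H"]) (auto simp: one_Ext nat_pow_def)
next
  case (Suc n)
  interpret E: group_extension G H E by (rule group_extension.intro[OF E])
  obtain E' :: "('h, 'h \<times> 'g, 'g) extension" where E': "is_extension G H E'"
      "ext_class G H E [^]\<^bsub>Ext G H\<^esub> n = ext_class G H E'" "ext_morphism H (\<lambda>h. h [^]\<^bsub>H\<^esub> n) E E'"
    using Suc by auto
  obtain E'' :: "('h, 'h \<times> 'g, 'g) extension" where E'': "is_extension G H E''"
      "ext_equiv G H (baer_sum G H E' E) E''" "ext_class G H E'' = ext_class G H (baer_sum G H E' E)"
    by (rule ext_class_representative[OF is_extension_baer_sum[OF E'(1) E]])
  have "ext_morphism H (\<lambda>h. h [^]\<^bsub>H\<^esub> n \<otimes>\<^bsub>H\<^esub> h) E (baer_sum G H E' E)"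
    by (rule ext_morphism_baer_sum[OF E E'(1) E E'(3) _ ext_morphism_refl]) auto
  then have "ext_morphism H (\<lambda>h. h [^]\<^bsub>H\<^esub> n \<otimes>\<^bsub>H\<^esub> h) E E''"
    by (rule ext_morphism_trans[of H _ E _ H "\<lambda>h. h", simplified])
      (use E''(2) in \<open>auto simp: ext_equiv_iff\<close>)
  then show ?case
    using E'' E' mult_Ext[OF E'(1) E] by (intro exI[of _ E'']) (auto simp: nat_pow_def)
qed

text \<open>As \<open>d\<close> is a homomorphism, \<open>d (n x) = n (d x) = x\<close>. Hence \<open>d\<close> is a two-sided inverse of
  multiplication by \<open>n\<close>, and the condition says that multiplication by \<open>n\<close> is a topological
  automorphism.\<close>

definition continuously_divisible :: "'h topgroup \<Rightarrow> bool" where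
  "continuously_divisible H \<longleftrightarrow>
     (\<forall>n::nat. n > 0 \<longrightarrow> (\<exists>d\<in>top_hom H H. \<forall>x\<in>carrier H. d x [^]\<^bsub>H\<^esub> n = x))"

lemma nat_pow_product:
  assumes "x \<in> (\<Pi>\<^sub>E i\<in>I. carrier (G i))"
  shows "x [^]\<^bsub>top_product_group I G\<^esub> (n::nat) = (\<lambda>i\<in>I. x i [^]\<^bsub>G i\<^esub> n)"
  by (induction n) (auto simp: nat_pow_def intro!: restrict_ext)

lemma continuously_divisible_product:
  assumes G: "\<And>i. i \<in> I \<Longrightarrow> continuously_divisible (G i)"
  shows "continuously_divisible (top_product_group I G)"
  unfolding continuously_divisible_def
proof (intro allI impI)
  fix n :: nat assume "n > 0"
  then have "\<exists>d\<in>top_hom (G i) (G i). \<forall>x\<in>carrier (G i). d x [^]\<^bsub>G i\<^esub> n = x" if "i \<in> I" for i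
    using G[OF that] by (simp add: continuously_divisible_def)
  then obtain d where d: "\<And>i. i \<in> I \<Longrightarrow> d i \<in> top_hom (G i) (G i)"
    "\<And>i x. i \<in> I \<Longrightarrow> x \<in> carrier (G i) \<Longrightarrow> d i x [^]\<^bsub>G i\<^esub> n = x"
    by metis
  let ?d = "\<lambda>x. \<lambda>i\<in>I. d i (x i)"
  have closed: "d i x \<in> carrier (G i)" if "i \<in> I" "x \<in> carrier (G i)" for i x
    using d(1)[OF that(1)] that(2) by (auto simp: top_hom_iff hom_def)
  have "?d \<in> hom (top_product_group I G) (top_product_group I G)"
  proof (rule homI)
    fix x y assume xy: "x \<in> carrier (top_product_group I G)" "y \<in> carrier (top_product_group I G)"
    show "?d x \<in> carrier (top_product_group I G)" using xy closed by (auto simp: PiE_iff)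
    show "?d (x \<otimes>\<^bsub>top_product_group I G\<^esub> y) = ?d x \<otimes>\<^bsub>top_product_group I G\<^esub> ?d y"
      using xy d(1) by (auto simp: PiE_iff top_hom_iff hom_def intro!: restrict_ext)
  qed
  moreover have "continuous_map (product_topology (\<lambda>i. topo (G i)) I) (topo (G i)) (\<lambda>x. d i (x i))"
    if "i \<in> I" for i
    using continuous_map_compose[OF continuous_map_product_projection[OF that, of "\<lambda>i. topo (G i)"]] d(1)[OF that]
    by (auto simp: top_hom_iff o_def)
  then have "continuous_map (topo (top_product_group I G)) (topo (top_product_group I G)) ?d"
    by (auto simp: continuous_map_componentwise)
  ultimately have "?d \<in> top_hom (top_product_group I G) (top_product_group I G)"
    by (simp only: top_hom_iff simp_thms)
  moreover have "?d x [^]\<^bsub>top_product_group I G\<^esub> n = x" if "x \<in> carrier (top_product_group I G)" for x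
  proof -
    have "?d x [^]\<^bsub>top_product_group I G\<^esub> n = (\<lambda>i\<in>I. ?d x i [^]\<^bsub>G i\<^esub> n)"
      using that closed by (intro nat_pow_product) (auto simp: PiE_iff)
    also have "\<dots> = (\<lambda>i\<in>I. x i)"
      using that d(2) by (intro restrict_ext) (auto simp: PiE_iff)
    also have "\<dots> = x" using that by (simp add: PiE_iff extensional_restrict)
    finally show ?thesis .
  qed
  ultimately show "\<exists>d\<in>top_hom (top_product_group I G) (top_product_group I G).
      \<forall>x\<in>carrier (top_product_group I G). d x [^]\<^bsub>top_product_group I G\<^esub> n = x"
    by (intro bexI[of _ ?d] ballI)
qed

text \<open>The push-out \<open>F\<close> of \<open>E\<close> along division by \<open>n\<close> satisfies \<open>n F = E\<close>: the composite of \<open>E \<rightarrow> F\<close> and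
  \<open>F \<rightarrow> n F\<close> is the identity on kernels.\<close>

theorem divisible_Ext:
  fixes G :: "'g topgroup" and H :: "'h topgroup"
  assumes G: "topological_ab_group G" and H: "topological_ab_group H"
    and div: "continuously_divisible H"
  shows "divisible (Ext G H)"
  unfolding divisible_def
proof (intro ballI allI impI)
  fix A and n :: nat assume "A \<in> carrier (Ext G H)" and n: "n > 0"
  from this(1) obtain E :: "('h, 'h \<times> 'g, 'g) extension"
    where E: "is_extension G H E" "A = ext_class G H E"
    by (rule Ext_carrierE)
  obtain d where d: "d \<in> top_hom H H" "\<forall>x\<in>carrier H. d x [^]\<^bsub>H\<^esub> n = x"
    using div n unfolding continuously_divisible_def by blast
  have dc: "d \<in> carrier H \<rightarrow> carrier H" using d(1) by (auto simp: top_hom_iff hom_def)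
  obtain F :: "('h, 'h \<times> 'g, 'g) extension"
    where F: "is_extension G H F" "ext_equiv G H (pushout_ext H H d E) F"
    "ext_class G H F = ext_class G H (pushout_ext H H d E)"
    by (rule ext_class_representative[OF is_extension_pushout_ext[OF E(1) H d(1)]])
  obtain F' :: "('h, 'h \<times> 'g, 'g) extension"
    where F': "is_extension G H F'" "ext_class G H F [^]\<^bsub>Ext G H\<^esub> n = ext_class G H F'"
      "ext_morphism H (\<lambda>h. h [^]\<^bsub>H\<^esub> n) F F'"
    using Ext_nat_pow[OF F(1), of n] by (elim exE conjE)
  have "ext_morphism H (\<lambda>h. d h) E F"
    by (rule ext_morphism_trans[OF ext_morphism_pushout_ext[OF E(1) H d(1)] _ dc])
      (use F(2) in \<open>auto simp: ext_equiv_iff\<close>)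
  then have "ext_morphism H (\<lambda>h. d h [^]\<^bsub>H\<^esub> n) E F'"
    by (rule ext_morphism_trans[OF _ F'(3) dc])
  then have "ext_morphism H (\<lambda>h. h) E F'"
    by (rule ext_morphism_cong) (use d(2) in auto)
  then have "ext_class G H F' = A"
    using E F'(1) ext_class_eq_iff[OF E(1) F'(1)] by (auto simp: ext_equiv_iff)
  then show "\<exists>B\<in>carrier (Ext G H). B [^]\<^bsub>Ext G H\<^esub> n = A"
    using F'(2) ext_class_in_Ext[OF F(1)] by (intro bexI[of _ "ext_class G H F"]) auto
qed

text \<open>If \<open>n E\<close> is trivial, then \<open>E\<close> maps to the trivial extension over multiplication by \<open>n\<close>. The
  trivial extension maps to itself over division by \<open>n\<close>, and the composite is the identity on
  kernels.\<close>

theorem torsion_free_Ext: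
  fixes G :: "'g topgroup" and H :: "'h topgroup"
  assumes G: "topological_ab_group G" and H: "topological_ab_group H"
    and div: "continuously_divisible H"
  shows "torsion_free (Ext G H)"
  unfolding torsion_free_def
proof (intro ballI allI impI)
  fix A and n :: nat
  assume "A \<in> carrier (Ext G H)" and n: "n > 0" and A: "A [^]\<^bsub>Ext G H\<^esub> n = \<one>\<^bsub>Ext G H\<^esub>"
  from this(1) obtain E :: "('h, 'h \<times> 'g, 'g) extension"
    where E: "is_extension G H E" "A = ext_class G H E"
    by (rule Ext_carrierE)
  interpret E: group_extension G H E by (rule group_extension.intro[OF E(1)])
  obtain d where d: "d \<in> top_hom H H" "\<forall>x\<in>carrier H. d x [^]\<^bsub>H\<^esub> n = x"
    using div n unfolding continuously_divisible_def by blast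
  interpret d: group_hom H H d by unfold_locales (use d(1) in \<open>simp add: top_hom_iff\<close>)
  note T = is_extension_trivial_ext[OF G H]
  obtain E' :: "('h, 'h \<times> 'g, 'g) extension"
    where E': "is_extension G H E'" "ext_class G H E [^]\<^bsub>Ext G H\<^esub> n = ext_class G H E'"
      "ext_morphism H (\<lambda>h. h [^]\<^bsub>H\<^esub> n) E E'"
    using Ext_nat_pow[OF E(1), of n] by (elim exE conjE)
  have "ext_equiv G H E' (trivial_ext G H)"
    using A E'(2) ext_class_eq_iff[OF E'(1) T] by (simp add: E(2) one_Ext)
  then have "ext_morphism H (\<lambda>h. h [^]\<^bsub>H\<^esub> n) E (trivial_ext G H)"
    using ext_morphism_trans[OF E'(3), of H "\<lambda>h. h" "trivial_ext G H"] by (auto simp: ext_equiv_iff)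
  then have "ext_morphism H (\<lambda>h. d (h [^]\<^bsub>H\<^esub> n)) E (trivial_ext G H)"
    by (rule ext_morphism_trans[OF _ ext_morphism_trivial_ext[OF d(1) G H H]]) auto
  then have "ext_morphism H (\<lambda>h. h) E (trivial_ext G H)"
    by (rule ext_morphism_cong) (use d(2) in \<open>auto simp: d.hom_nat_pow\<close>)
  then show "A = \<one>\<^bsub>Ext G H\<^esub>"
    using E T ext_class_eq_iff[OF E(1) T] by (auto simp: ext_equiv_iff one_Ext)
qed

section \<open>The p-adic absolute value\<close>

locale prime_number =
  fixes p :: nat
  assumes prime_p: "prime p"
begin

abbreviation v :: "int \<Rightarrow> int" where "v a \<equiv> int (multiplicity (int p) a)"

lemma prime_elem_p: "prime_elem (int p)"
  using prime_p by simp

lemma v_mult: "a \<noteq> 0 \<Longrightarrow> b \<noteq> 0 \<Longrightarrow> v (a * b) = v a + v b"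
  by (simp add: prime_elem_multiplicity_mult_distrib[OF prime_elem_p])

lemma p_gt_1: "real p > 1"
  using prime_gt_1_nat[OF prime_p] by simp

lemma padic_abs_0 [simp]: "padic_abs p 0 = 0"
  by (simp add: padic_abs_def)

text \<open>The formula holds for fractions that are not in lowest terms. This allows a common
  denominator in the proof of the ultrametric inequality.\<close>

lemma padic_abs_fraction:
  assumes "a \<noteq> 0" "b \<noteq> 0"
  shows "padic_abs p (of_int a / of_int b) = real p powi (v b - v a)"
proof -
  obtain n d where q: "quotient_of (of_int a / of_int b) = (n, d)" by force
  have d: "d > 0" by (rule quotient_of_denom_pos[OF q])
  have "of_int a / of_int b = (of_int n / of_int d :: rat)" by (rule quotient_of_div[OF q])
  then have "of_int (a * d) = (of_int (n * b) :: rat)" using d assms by (simp add: field_simps)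
  then have eq: "a * d = n * b" by (simp only: of_int_eq_iff)
  then have "n \<noteq> 0" using assms d by auto
  then have "v a + v d = v n + v b" using arg_cong[OF eq, of v] assms d by (simp add: v_mult del: of_nat_add)
  then show ?thesis using assms by (simp add: padic_abs_def q algebra_simps) (smt (verit))
qed

lemma fraction:
  fixes x :: rat
  assumes "x \<noteq> 0"
  obtains a b where "a \<noteq> 0" "b \<noteq> 0" "x = of_int a / of_int b"
proof -
  obtain a b where q: "quotient_of x = (a, b)" by force
  have "b > 0" "x = of_int a / of_int b" by (rule quotient_of_denom_pos[OF q], rule quotient_of_div[OF q])
  then show thesis using assms by (intro that[of a b]) auto
qed

lemma padic_abs_pos: "x \<noteq> 0 \<Longrightarrow> padic_abs p x > 0"
  using p_gt_1 by (simp add: padic_abs_def)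

lemma padic_abs_nonneg [simp]: "padic_abs p x \<ge> 0"
  using padic_abs_pos[of x] by (cases "x = 0") auto

lemma padic_abs_mult: "padic_abs p (x * y) = padic_abs p x * padic_abs p y"
proof (cases "x = 0 \<or> y = 0")
  case False
  obtain a b where x: "a \<noteq> 0" "b \<noteq> 0" "x = of_int a / of_int b" using False fraction by blast
  obtain c d where y: "c \<noteq> 0" "d \<noteq> 0" "y = of_int c / of_int d" using False fraction by blast
  have "x * y = of_int (a * c) / of_int (b * d)" by (simp add: x y)
  then have "padic_abs p (x * y) = real p powi (v (b * d) - v (a * c))"
    using x(1,2) y(1,2) by (simp only: padic_abs_fraction mult_eq_0_iff simp_thms)
  also have "v (b * d) - v (a * c) = (v b - v a) + (v d - v c)" using x y by (simp add: v_mult del: of_nat_add)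
  also have "real p powi \<dots> = padic_abs p x * padic_abs p y"
    using x y p_gt_1 by (simp add: padic_abs_fraction power_int_add)
  finally show ?thesis .
qed auto

lemma padic_abs_minus [simp]: "padic_abs p (- x) = padic_abs p x"
proof -
  have "padic_abs p (-1) * padic_abs p (-1) = 1"
    using padic_abs_fraction[of 1 1] by (simp flip: padic_abs_mult)
  then have "padic_abs p (-1) = 1"
    using padic_abs_nonneg[of "-1"] by (metis abs_of_nonneg abs_mult_self_eq mult.commute power2_eq_1_iff power2_eq_square abs_minus_cancel abs_one)
  then show ?thesis using padic_abs_mult[of "-1" x] by simp
qed

lemma padic_abs_diff_commute: "padic_abs p (x - y) = padic_abs p (y - x)"
  using padic_abs_minus[of "x - y"] by simp

lemma padic_abs_add_le_max: "padic_abs p (x + y) \<le> max (padic_abs p x) (padic_abs p y)"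
proof (cases "x = 0 \<or> y = 0 \<or> x + y = 0")
  case False
  obtain a b where x: "a \<noteq> 0" "b \<noteq> 0" "x = of_int a / of_int b" using False fraction by blast
  obtain c d where y: "c \<noteq> 0" "d \<noteq> 0" "y = of_int c / of_int d" using False fraction by blast
  have xy: "x = of_int (a * d) / of_int (b * d)" "y = of_int (c * b) / of_int (b * d)"
    "x + y = of_int (a * d + c * b) / of_int (b * d)"
    using x y by (simp_all add: field_simps)
  have nz: "a * d \<noteq> 0" "c * b \<noteq> 0" "b * d \<noteq> 0" "a * d + c * b \<noteq> 0"
    using x y False xy(3) by (auto simp del: of_int_add of_int_mult)
  define k where "k = min (multiplicity (int p) (a * d)) (multiplicity (int p) (c * b))"
  have "int p ^ k dvd a * d" "int p ^ k dvd c * b"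
    unfolding k_def by (intro multiplicity_dvd'; simp)+
  then have "k \<le> multiplicity (int p) (a * d + c * b)"
    using nz prime_gt_1_nat[OF prime_p] by (intro multiplicity_geI) auto
  then have "v (b * d) - v (a * d + c * b) \<le> v (b * d) - int k" by simp
  then have "padic_abs p (x + y) \<le> real p powi (v (b * d) - int k)"
    unfolding xy(3) padic_abs_fraction[OF nz(4,3)] using p_gt_1 by (intro power_int_increasing) auto
  moreover have "int k = v (a * d) \<or> int k = v (c * b)" by (auto simp: k_def min_def)
  ultimately show ?thesis
    unfolding xy(1,2) padic_abs_fraction[OF nz(1,3)] padic_abs_fraction[OF nz(2,3)] xy(3)
    by (auto simp: le_max_iff_disj simp flip: xy(1,2))
qed (auto simp: le_max_iff_disj)

lemma padic_abs_add_le: "padic_abs p (x + y) \<le> padic_abs p x + padic_abs p y"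
  using padic_abs_add_le_max[of x y] padic_abs_nonneg[of x] padic_abs_nonneg[of y] by linarith

lemma padic_abs_reverse_triangle: "\<bar>padic_abs p x - padic_abs p y\<bar> \<le> padic_abs p (x - y)"
  using padic_abs_add_le[of "x - y" y] padic_abs_add_le[of "y - x" x] padic_abs_diff_commute[of x y]
  by simp

section \<open>The p-adic numbers as a topological group\<close>

lemma Metric_space_padic_abs: "Metric_space UNIV (\<lambda>x y. padic_abs p (x - y))"
proof
  fix x y z :: rat
  show "padic_abs p (x - y) = 0 \<longleftrightarrow> x = y"
    using padic_abs_pos[of "x - y"] by (cases "x = y") auto
  show "padic_abs p (x - z) \<le> padic_abs p (x - y) + padic_abs p (y - z)"
    using padic_abs_add_le[of "x - y" "y - z"] by simp
qed (auto simp: padic_abs_diff_commute)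

abbreviation \<C> :: "(nat \<Rightarrow> rat) monoid" where "\<C> \<equiv> padic_cauchy_group p"
abbreviation \<N> :: "(nat \<Rightarrow> rat) set" where "\<N> \<equiv> padic_null p"

lemma cauchy_group_simps [simp]:
  "s \<otimes>\<^bsub>\<C>\<^esub> t = (\<lambda>n. s n + t n)" "\<one>\<^bsub>\<C>\<^esub> = (\<lambda>n. 0)"
  by (simp_all add: padic_cauchy_group_def)

lemma cauchy_iff:
  "s \<in> carrier \<C> \<longleftrightarrow> (\<forall>\<epsilon>>0. \<exists>N. \<forall>m n. N \<le> m \<longrightarrow> N \<le> n \<longrightarrow> padic_abs p (s m - s n) < \<epsilon>)"
  by (simp add: padic_cauchy_group_def Metric_space.MCauchy_def[OF Metric_space_padic_abs])

lemma null_iff: "s \<in> \<N> \<longleftrightarrow> (\<lambda>n. padic_abs p (s n)) \<longlonglongrightarrow> 0"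
  by (simp add: padic_null_def)

lemma cauchyE:
  assumes "s \<in> carrier \<C>" "\<epsilon> > 0"
  obtains N where "\<forall>m n. N \<le> m \<longrightarrow> N \<le> n \<longrightarrow> padic_abs p (s m - s n) < \<epsilon>"
  using assms(1)[unfolded cauchy_iff, rule_format, OF assms(2)] by (elim exE)

lemma cauchy_add:
  assumes s: "s \<in> carrier \<C>" and t: "t \<in> carrier \<C>"
  shows "(\<lambda>n. s n + t n) \<in> carrier \<C>"
  unfolding cauchy_iff
proof (intro allI impI)
  fix \<epsilon> :: real assume \<epsilon>: "\<epsilon> > 0"
  obtain N1 where N1: "\<forall>m n. N1 \<le> m \<longrightarrow> N1 \<le> n \<longrightarrow> padic_abs p (s m - s n) < \<epsilon>"
    using s \<epsilon> by (rule cauchyE)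
  obtain N2 where N2: "\<forall>m n. N2 \<le> m \<longrightarrow> N2 \<le> n \<longrightarrow> padic_abs p (t m - t n) < \<epsilon>"
    using t \<epsilon> by (rule cauchyE)
  have "padic_abs p (s m + t m - (s n + t n)) < \<epsilon>" if "max N1 N2 \<le> m" "max N1 N2 \<le> n" for m n
    using padic_abs_add_le_max[of "s m - s n" "t m - t n"] N1[rule_format, of m n]
      N2[rule_format, of m n] that
    by (simp add: algebra_simps)
  then show "\<exists>N. \<forall>m n. N \<le> m \<longrightarrow> N \<le> n \<longrightarrow> padic_abs p (s m + t m - (s n + t n)) < \<epsilon>"
    by (intro exI allI impI)
qed

lemma cauchy_scale: "s \<in> carrier \<C> \<Longrightarrow> (\<lambda>n. c * s n) \<in> carrier \<C>"
proof (cases "c = 0")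
  case True
  then show ?thesis by (simp add: cauchy_iff)
next
  case False
  assume s: "s \<in> carrier \<C>"
  show ?thesis
    unfolding cauchy_iff
  proof (intro allI impI)
    fix \<epsilon> :: real assume "\<epsilon> > 0"
    then have "\<epsilon> / padic_abs p c > 0" using padic_abs_pos[OF False] by simp
    with s obtain N where N: "\<forall>m n. N \<le> m \<longrightarrow> N \<le> n \<longrightarrow> padic_abs p (s m - s n) < \<epsilon> / padic_abs p c"
      by (rule cauchyE)
    have "padic_abs p (c * s m - c * s n) < \<epsilon>" if "N \<le> m" "N \<le> n" for m n
      using N[rule_format, OF that] padic_abs_pos[OF False]
      unfolding right_diff_distrib[symmetric] padic_abs_mult by (simp add: pos_less_divide_eq mult.commute)
    then show "\<exists>N. \<forall>m n. N \<le> m \<longrightarrow> N \<le> n \<longrightarrow> padic_abs p (c * s m - c * s n) < \<epsilon>"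
      by (intro exI allI impI)
  qed
qed

lemma null_add: "s \<in> \<N> \<Longrightarrow> t \<in> \<N> \<Longrightarrow> (\<lambda>n. s n + t n) \<in> \<N>"
  unfolding null_iff
  by (rule tendsto_sandwich[of "\<lambda>_. 0" _ _ "\<lambda>n. padic_abs p (s n) + padic_abs p (t n)"])
    (auto simp: padic_abs_add_le intro!: tendsto_add_zero)

lemma null_scale: "s \<in> \<N> \<Longrightarrow> (\<lambda>n. c * s n) \<in> \<N>"
  unfolding null_iff padic_abs_mult by (rule tendsto_mult_right_zero)

lemma null_cauchy: "s \<in> \<N> \<Longrightarrow> s \<in> carrier \<C>"
  unfolding cauchy_iff
proof (intro allI impI)
  fix \<epsilon> :: real assume "s \<in> \<N>" "\<epsilon> > 0"
  then obtain N where N: "\<And>n. N \<le> n \<Longrightarrow> padic_abs p (s n) < \<epsilon>"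
    unfolding null_iff LIMSEQ_iff by auto
  have "padic_abs p (s m - s n) < \<epsilon>" if "N \<le> m" "N \<le> n" for m n
    using padic_abs_add_le_max[of "s m" "- s n"] N[OF that(1)] N[OF that(2)] by simp
  then show "\<exists>N. \<forall>m n. N \<le> m \<longrightarrow> N \<le> n \<longrightarrow> padic_abs p (s m - s n) < \<epsilon>"
    by (intro exI allI impI)
qed

lemma comm_group_cauchy: "comm_group \<C>"
proof (rule comm_groupI)
  fix s assume s: "s \<in> carrier \<C>"
  show "\<exists>t\<in>carrier \<C>. t \<otimes>\<^bsub>\<C>\<^esub> s = \<one>\<^bsub>\<C>\<^esub>"
    using cauchy_scale[OF s, of "-1"] by (rule bexI[rotated]) simp
qed (auto simp: cauchy_add cauchy_iff[of "\<lambda>n. 0"] algebra_simps)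

sublocale C: comm_group \<C> by (rule comm_group_cauchy)

lemma inv_cauchy: "s \<in> carrier \<C> \<Longrightarrow> inv\<^bsub>\<C>\<^esub> s = (\<lambda>n. - s n)"
  using cauchy_scale[of s "-1"] by (intro C.inv_equality) auto

lemma subgroup_null: "subgroup \<N> \<C>"
proof (rule C.subgroupI)
  have "(\<lambda>n. 0) \<in> \<N>" by (simp add: null_iff)
  then show "\<N> \<noteq> {}" by auto
  show "inv\<^bsub>\<C>\<^esub> s \<in> \<N>" if "s \<in> \<N>" for s
    using null_scale[OF that, of "-1"] null_cauchy[OF that] by (simp add: inv_cauchy)
qed (auto simp: null_cauchy null_add)

sublocale Q: comm_group "padic_group p"
  unfolding padic_group_def by (rule C.abelian_FactGroup[OF subgroup_null])

text \<open>The \<open>p\<close>-adic number represented by a Cauchy sequence.\<close>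

definition cls :: "(nat \<Rightarrow> rat) \<Rightarrow> (nat \<Rightarrow> rat) set" where "cls s = \<N> #>\<^bsub>\<C>\<^esub> s"

lemma carrier_padic: "carrier (padic_group p) = cls ` carrier \<C>"
  by (auto simp: padic_group_def FactGroup_def RCOSETS_def cls_def)

sublocale cls: group_hom \<C> "padic_group p" cls
  using normal.r_coset_hom_Mod[OF C.normal_iff_subgroup[THEN iffD2, OF subgroup_null]]
  by unfold_locales (simp add: cls_def[abs_def] padic_group_def)

lemma in_cls_iff: "t \<in> cls s \<longleftrightarrow> (\<lambda>n. t n - s n) \<in> \<N>"
proof
  assume "t \<in> cls s"
  then show "(\<lambda>n. t n - s n) \<in> \<N>" by (auto simp: cls_def r_coset_def)
next
  assume "(\<lambda>n. t n - s n) \<in> \<N>"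
  then show "t \<in> cls s"
    by (auto simp: cls_def r_coset_def intro!: bexI[of _ "\<lambda>n. t n - s n"])
qed

lemma cls_self: "s \<in> cls s"
  by (simp add: in_cls_iff null_iff)

lemma cls_eq_iff: "cls s = cls t \<longleftrightarrow> (\<lambda>n. s n - t n) \<in> \<N>"
proof
  assume "cls s = cls t"
  then show "(\<lambda>n. s n - t n) \<in> \<N>" using cls_self[of s] in_cls_iff by simp
next
  assume st: "(\<lambda>n. s n - t n) \<in> \<N>"
  have "(\<lambda>n. u n - t n) \<in> \<N>" if "(\<lambda>n. u n - s n) \<in> \<N>" for u
    using null_add[OF that st] by simp
  moreover have "(\<lambda>n. u n - s n) \<in> \<N>" if "(\<lambda>n. u n - t n) \<in> \<N>" for u
    using null_add[OF that null_scale[OF st, of "-1"]] by simp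
  ultimately show "cls s = cls t" by (auto simp: in_cls_iff)
qed

lemma convergent_padic_abs:
  assumes "s \<in> carrier \<C>"
  shows "convergent (\<lambda>n. padic_abs p (s n))"
proof (rule Cauchy_convergent, rule CauchyI')
  fix \<epsilon> :: real assume "\<epsilon> > 0"
  with assms obtain N where N: "\<forall>m n. N \<le> m \<longrightarrow> N \<le> n \<longrightarrow> padic_abs p (s m - s n) < \<epsilon>"
    by (rule cauchyE)
  have "dist (padic_abs p (s m)) (padic_abs p (s n)) < \<epsilon>" if "N \<le> m" "m < n" for m n
    using padic_abs_reverse_triangle[of "s m" "s n"] N[rule_format, of m n] that by (simp add: dist_real_def)
  then show "\<exists>M. \<forall>m\<ge>M. \<forall>n>m. dist (padic_abs p (s m)) (padic_abs p (s n)) < \<epsilon>" by blast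
qed

text \<open>The distance is a limit for any choice of representatives, so inequalities for the absolute value
  of rational numbers pass to the limit.\<close>

lemma padic_dist_limit:
  assumes s: "s \<in> carrier \<C>" and t: "t \<in> carrier \<C>"
  shows "(\<lambda>n. padic_abs p (s n - t n)) \<longlonglongrightarrow> padic_dist p (cls s) (cls t)"
proof -
  have "(\<lambda>n. s n - t n) \<in> carrier \<C>"
    using cauchy_add[OF s cauchy_scale[OF t, of "-1"]] by simp
  then obtain l where l: "(\<lambda>n. padic_abs p (s n - t n)) \<longlonglongrightarrow> l"
    using convergent_padic_abs by (auto simp: convergent_def)
  have l_unique: "d = l"
    if st: "s' \<in> cls s" "t' \<in> cls t" and d: "(\<lambda>n. padic_abs p (s' n - t' n)) \<longlonglongrightarrow> d" for s' t' d
  proof -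
    have "(\<lambda>n. (s' n - s n) + (- 1) * (t' n - t n)) \<in> \<N>"
      using st null_add null_scale[of "\<lambda>n. t' n - t n" "-1"] by (simp add: in_cls_iff)
    then have z: "(\<lambda>n. padic_abs p ((s' n - t' n) - (s n - t n))) \<longlonglongrightarrow> 0"
      by (simp add: null_iff algebra_simps)
    have "(\<lambda>n. padic_abs p (s' n - t' n) - padic_abs p (s n - t n)) \<longlonglongrightarrow> 0"
      by (rule Lim_null_comparison[OF _ z]) (simp add: padic_abs_reverse_triangle)
    from tendsto_add[OF this l] have "(\<lambda>n. padic_abs p (s' n - t' n)) \<longlonglongrightarrow> l" by simp
    then show "d = l" by (rule LIMSEQ_unique[OF d])
  qed
  have "padic_dist p (cls s) (cls t) = (THE d. \<exists>s'\<in>cls s. \<exists>t'\<in>cls t. (\<lambda>n. padic_abs p (s' n - t' n)) \<longlonglongrightarrow> d)"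
    using s t by (simp add: padic_dist_def)
  also have "\<dots> = l"
    by (rule the_equality) (use l cls_self l_unique in blast)+
  finally show ?thesis using l by simp
qed

lemma padic_carrierE:
  assumes "A \<in> carrier (padic_group p)"
  obtains s where "s \<in> carrier \<C>" "A = cls s"
  using assms by (auto simp: carrier_padic)

sublocale M: Metric_space "carrier (padic_group p)" "padic_dist p"
proof
  show "0 \<le> padic_dist p A B" for A B
  proof (cases "A \<in> carrier (padic_group p) \<and> B \<in> carrier (padic_group p)")
    case True
    then obtain s t where "s \<in> carrier \<C>" "A = cls s" "t \<in> carrier \<C>" "B = cls t"
      by (metis padic_carrierE)
    then show ?thesis using LIMSEQ_le_const[OF padic_dist_limit[of s t], of 0] by auto
  qed (auto simp: padic_dist_def)
  show "padic_dist p A B = padic_dist p B A" for A B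
  proof (cases "A \<in> carrier (padic_group p) \<and> B \<in> carrier (padic_group p)")
    case True
    then obtain s t where st: "s \<in> carrier \<C>" "A = cls s" "t \<in> carrier \<C>" "B = cls t"
      by (metis padic_carrierE)
    have "(\<lambda>n. padic_abs p (s n - t n)) \<longlonglongrightarrow> padic_dist p B A"
      using padic_dist_limit[of t s] st by (simp add: padic_abs_diff_commute)
    then show ?thesis using LIMSEQ_unique[OF padic_dist_limit[of s t]] st by simp
  qed (auto simp: padic_dist_def)
  fix A B assume A: "A \<in> carrier (padic_group p)" and B: "B \<in> carrier (padic_group p)"
  obtain s where s: "s \<in> carrier \<C>" "A = cls s" using A by (rule padic_carrierE)
  obtain t where t: "t \<in> carrier \<C>" "B = cls t" using B by (rule padic_carrierE)
  note st = padic_dist_limit[OF s(1) t(1)]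
  show "padic_dist p A B = 0 \<longleftrightarrow> A = B"
    using st LIMSEQ_unique[OF st, of 0] by (auto simp: s t cls_eq_iff null_iff)
  fix C assume "C \<in> carrier (padic_group p)"
  then obtain u where u: "u \<in> carrier \<C>" "C = cls u" by (rule padic_carrierE)
  show "padic_dist p A C \<le> padic_dist p A B + padic_dist p B C"
    unfolding s t u
  proof (rule LIMSEQ_le[OF padic_dist_limit tendsto_add[OF padic_dist_limit padic_dist_limit]])
    have "padic_abs p (s n - u n) \<le> padic_abs p (s n - t n) + padic_abs p (t n - u n)" for n
      using padic_abs_add_le[of "s n - t n" "t n - u n"] by simp
    then show "\<exists>N. \<forall>n\<ge>N. padic_abs p (s n - u n) \<le> padic_abs p (s n - t n) + padic_abs p (t n - u n)"
      by (intro exI allI impI)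
  qed (intro s t u)+
qed

lemma padic_dist_scale:
  assumes "s \<in> carrier \<C>" "t \<in> carrier \<C>"
  shows "padic_dist p (cls (\<lambda>n. c * s n)) (cls (\<lambda>n. c * t n)) = padic_abs p c * padic_dist p (cls s) (cls t)"
proof (rule LIMSEQ_unique[OF padic_dist_limit])
  show "(\<lambda>n. padic_abs p (c * s n - c * t n)) \<longlonglongrightarrow> padic_abs p c * padic_dist p (cls s) (cls t)"
    using tendsto_mult_left[OF padic_dist_limit[OF assms], of "padic_abs p c"]
    by (simp add: padic_abs_mult flip: right_diff_distrib)
qed (intro cauchy_scale assms)+

lemma padic_dist_mult:
  assumes "A \<in> carrier (padic_group p)" "A' \<in> carrier (padic_group p)"
    "B \<in> carrier (padic_group p)" "B' \<in> carrier (padic_group p)"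
  shows "padic_dist p (A \<otimes>\<^bsub>padic_group p\<^esub> B) (A' \<otimes>\<^bsub>padic_group p\<^esub> B') \<le> padic_dist p A A' + padic_dist p B B'"
proof -
  obtain s s' t t' where r: "s \<in> carrier \<C>" "A = cls s" "s' \<in> carrier \<C>" "A' = cls s'"
    "t \<in> carrier \<C>" "B = cls t" "t' \<in> carrier \<C>" "B' = cls t'"
    using assms by (metis padic_carrierE)
  have "padic_dist p (cls (\<lambda>n. s n + t n)) (cls (\<lambda>n. s' n + t' n)) \<le> padic_dist p (cls s) (cls s') + padic_dist p (cls t) (cls t')"
  proof (rule LIMSEQ_le[OF padic_dist_limit tendsto_add[OF padic_dist_limit padic_dist_limit]])
    have "padic_abs p (s n + t n - (s' n + t' n)) \<le> padic_abs p (s n - s' n) + padic_abs p (t n - t' n)" for n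
      using padic_abs_add_le[of "s n - s' n" "t n - t' n"] by (simp add: algebra_simps)
    then show "\<exists>N. \<forall>n\<ge>N. padic_abs p (s n + t n - (s' n + t' n)) \<le> padic_abs p (s n - s' n) + padic_abs p (t n - t' n)"
      by (intro exI allI impI)
  qed (intro cauchy_add r)+
  then show ?thesis using r cls.hom_mult[of s t] cls.hom_mult[of s' t'] by simp
qed

text \<open>Multiplication by \<open>c\<close>. For \<open>c \<noteq> 0\<close> the elementwise image of a class is again a full class,
  because null sequences remain null sequences when they are divided by \<open>c\<close>.\<close>

definition scale :: "rat \<Rightarrow> (nat \<Rightarrow> rat) set \<Rightarrow> (nat \<Rightarrow> rat) set" where
  "scale c A = (\<lambda>s n. c * s n) ` A"

lemma scale_cls:
  assumes "c \<noteq> 0"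
  shows "scale c (cls s) = cls (\<lambda>n. c * s n)"
proof (intro subset_antisym subsetI)
  fix t assume "t \<in> scale c (cls s)"
  then obtain u where u: "(\<lambda>n. u n - s n) \<in> \<N>" "t = (\<lambda>n. c * u n)"
    by (auto simp: scale_def in_cls_iff)
  show "t \<in> cls (\<lambda>n. c * s n)"
    using null_scale[OF u(1), of c] by (simp add: in_cls_iff u(2) right_diff_distrib)
next
  fix t assume "t \<in> cls (\<lambda>n. c * s n)"
  then have "(\<lambda>n. t n - c * s n) \<in> \<N>" by (simp add: in_cls_iff)
  from null_scale[OF this, of "inverse c"] have "(\<lambda>n. inverse c * t n) \<in> cls s"
    using assms by (simp add: in_cls_iff right_diff_distrib flip: mult.assoc)
  then show "t \<in> scale c (cls s)"
    unfolding scale_def by (rule rev_image_eqI) (use assms in \<open>simp add: fun_eq_iff\<close>)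
qed

lemma scale_closed: "c \<noteq> 0 \<Longrightarrow> A \<in> carrier (padic_group p) \<Longrightarrow> scale c A \<in> carrier (padic_group p)"
  by (elim padic_carrierE) (auto simp: scale_cls cauchy_scale)

lemma scale_hom: "c \<noteq> 0 \<Longrightarrow> scale c \<in> hom (padic_group p) (padic_group p)"
proof (rule homI)
  fix A B assume c: "c \<noteq> 0" and AB: "A \<in> carrier (padic_group p)" "B \<in> carrier (padic_group p)"
  obtain s t where r: "s \<in> carrier \<C>" "A = cls s" "t \<in> carrier \<C>" "B = cls t"
    using AB by (metis padic_carrierE)
  have "scale c (A \<otimes>\<^bsub>padic_group p\<^esub> B) = cls (\<lambda>n. c * s n + c * t n)"
    using r c cls.hom_mult[of s t] scale_cls[OF c, of "\<lambda>n. s n + t n"] by (simp add: distrib_left)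
  also have "\<dots> = scale c A \<otimes>\<^bsub>padic_group p\<^esub> scale c B"
    using r c cls.hom_mult[of "\<lambda>n. c * s n" "\<lambda>n. c * t n"] by (simp add: scale_cls cauchy_scale)
  finally show "scale c (A \<otimes>\<^bsub>padic_group p\<^esub> B) = scale c A \<otimes>\<^bsub>padic_group p\<^esub> scale c B" .
qed (rule scale_closed)

lemma inv_eq_scale: "A \<in> carrier (padic_group p) \<Longrightarrow> inv\<^bsub>padic_group p\<^esub> A = scale (-1) A"
  using cls.hom_inv by (elim padic_carrierE) (auto simp: scale_cls inv_cauchy)

text \<open>Multiplication by \<open>c\<close> multiplies all distances by the constant \<open>padic_abs p c\<close>.\<close>

lemma scale_continuous:
  assumes c: "c \<noteq> 0"
  shows "continuous_map M.mtopology M.mtopology (scale c)"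
proof -
  have "openin M.mtopology {A \<in> carrier (padic_group p). scale c A \<in> U}" if U: "openin M.mtopology U" for U
    unfolding M.openin_mtopology
  proof (intro conjI allI impI)
    fix A assume "A \<in> {A \<in> carrier (padic_group p). scale c A \<in> U}"
    then have A: "A \<in> carrier (padic_group p)" "scale c A \<in> U" by auto
    then obtain r where r: "r > 0" "M.mball (scale c A) r \<subseteq> U"
      using U unfolding M.openin_mtopology by blast
    have "scale c B \<in> U" if B: "B \<in> M.mball A (r / padic_abs p c)" for B
    proof -
      obtain s t where st: "s \<in> carrier \<C>" "A = cls s" "t \<in> carrier \<C>" "B = cls t"
        using A(1) B by (metis M.in_mball padic_carrierE)
      have "padic_dist p (scale c A) (scale c B) < r"
        using B st padic_abs_pos[OF c] by (simp add: scale_cls[OF c] padic_dist_scale field_simps)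
      then show ?thesis using r(2) scale_closed[OF c] A(1) B by (auto simp: subset_iff)
    qed
    moreover have "r / padic_abs p c > 0" using r(1) padic_abs_pos[OF c] by simp
    ultimately show "\<exists>r>0. M.mball A r \<subseteq> {A \<in> carrier (padic_group p). scale c A \<in> U}"
      by (intro exI[of _ "r / padic_abs p c"]) auto
  qed auto
  then show ?thesis using scale_closed[OF c] by (auto simp: continuous_map_def)
qed

lemma mult_continuous:
  "continuous_map (prod_topology M.mtopology M.mtopology) M.mtopology
     (\<lambda>z. fst z \<otimes>\<^bsub>padic_group p\<^esub> snd z)"
proof -
  let ?Q = "padic_group p"
  have "openin (prod_topology M.mtopology M.mtopology)
      {z \<in> carrier ?Q \<times> carrier ?Q. fst z \<otimes>\<^bsub>?Q\<^esub> snd z \<in> U}" if U: "openin M.mtopology U" for U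
    unfolding openin_prod_topology_alt
  proof (intro allI impI)
    fix A B assume "(A, B) \<in> {z \<in> carrier ?Q \<times> carrier ?Q. fst z \<otimes>\<^bsub>?Q\<^esub> snd z \<in> U}"
    then have AB: "A \<in> carrier ?Q" "B \<in> carrier ?Q" "A \<otimes>\<^bsub>?Q\<^esub> B \<in> U" by auto
    then obtain r where r: "r > 0" "M.mball (A \<otimes>\<^bsub>?Q\<^esub> B) r \<subseteq> U"
      using U unfolding M.openin_mtopology by blast
    have "A' \<otimes>\<^bsub>?Q\<^esub> B' \<in> U" if "A' \<in> M.mball A (r/2)" "B' \<in> M.mball B (r/2)" for A' B'
    proof -
      have "A' \<otimes>\<^bsub>?Q\<^esub> B' \<in> M.mball (A \<otimes>\<^bsub>?Q\<^esub> B) r"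
        using that AB padic_dist_mult[of A A' B B'] by auto
      then show ?thesis using r(2) by (rule rev_subsetD)
    qed
    then show "\<exists>V W. openin M.mtopology V \<and> openin M.mtopology W \<and> A \<in> V \<and> B \<in> W \<and>
        V \<times> W \<subseteq> {z \<in> carrier ?Q \<times> carrier ?Q. fst z \<otimes>\<^bsub>?Q\<^esub> snd z \<in> U}"
      using AB(1,2) r(1) by (intro exI[of _ "M.mball A (r/2)"] exI[of _ "M.mball B (r/2)"]) auto
  qed
  then show ?thesis by (auto simp: continuous_map_def)
qed

lemma Qp_simps:
  "carrier (Qp p) = carrier (padic_group p)" "monoid.mult (Qp p) = monoid.mult (padic_group p)"
  "one (Qp p) = one (padic_group p)" "topo (Qp p) = M.mtopology"
  by (simp_all add: Qp_def)

lemma topological_ab_group_Qp: "topological_ab_group (Qp p)"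
proof (rule topological_ab_groupI)
  show "comm_group (Qp p)"
    by (rule comm_group_cong[OF Q.comm_group_axioms]) (simp_all add: Qp_simps)
  have "continuous_map M.mtopology M.mtopology (m_inv (padic_group p))"
    by (rule continuous_map_eq[OF scale_continuous[of "-1"]]) (auto simp: inv_eq_scale)
  then show "continuous_map (topo (Qp p)) (topo (Qp p)) (m_inv (Qp p))"
    by (simp add: Qp_simps m_inv_cong[of "Qp p" "padic_group p"])
qed (simp_all add: Qp_simps M.Hausdorff_space_mtopology mult_continuous)

lemma nat_pow_Qp:
  assumes "s \<in> carrier \<C>"
  shows "cls s [^]\<^bsub>Qp p\<^esub> (n::nat) = cls (\<lambda>k. of_nat n * s k)"
proof (induction n)
  case 0
  show ?case using cls.hom_one by (simp add: nat_pow_def Qp_simps)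
next
  case (Suc n)
  then show ?case
    using cls.hom_mult[of "\<lambda>k. of_nat n * s k" s] assms
    by (simp add: nat_pow_def Qp_simps cauchy_scale algebra_simps)
qed

lemma continuously_divisible_Qp: "continuously_divisible (Qp p)"
  unfolding continuously_divisible_def
proof (intro allI impI, rule bexI[of _ "scale (inverse (of_nat n))" for n])
  fix n :: nat assume assms: "n > 0"
  have n: "inverse (of_nat n) \<noteq> (0 :: rat)" using assms by simp
  show "scale (inverse (of_nat n)) \<in> top_hom (Qp p) (Qp p)"
    using scale_hom[OF n] scale_continuous[OF n] by (simp add: top_hom_iff hom_def Qp_simps)
  show "\<forall>A\<in>carrier (Qp p). scale (inverse (of_nat n)) A [^]\<^bsub>Qp p\<^esub> n = A"
  proof
    fix A assume "A \<in> carrier (Qp p)"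
    then obtain s where s: "s \<in> carrier \<C>" "A = cls s" unfolding Qp_simps by (rule padic_carrierE)
    have "scale (inverse (of_nat n)) A = cls (\<lambda>k. inverse (of_nat n) * s k)"
      unfolding s(2) by (rule scale_cls[OF n])
    then show "scale (inverse (of_nat n)) A [^]\<^bsub>Qp p\<^esub> n = A"
      using nat_pow_Qp[OF cauchy_scale[OF s(1)], of "inverse (of_nat n)" n] assms
      by (simp add: s(2) flip: mult.assoc)
  qed
qed

end

section \<open>Extensions by products of p-adic numbers\<close>

lemma topological_ab_group_padic_product: "topological_ab_group (padic_product \<alpha>)"
  unfolding padic_product_def
  by (intro topological_ab_group_product prime_number.topological_ab_group_Qp prime_number.intro) simp

lemma continuously_divisible_padic_product: "continuously_divisible (padic_product \<alpha>)"
  unfolding padic_product_def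
  by (intro continuously_divisible_product prime_number.continuously_divisible_Qp prime_number.intro) simp

theorem corollary18:
  fixes G :: "'g topgroup" and \<alpha> :: "nat \<Rightarrow> 'i rel"
  assumes "topological_ab_group G"
    and "locally_precompact G"
    and "\<And>p. prime p \<Longrightarrow> Well_order (\<alpha> p)"
  shows "comm_group (Ext G (padic_product \<alpha>)) \<and>
         divisible (Ext G (padic_product \<alpha>)) \<and>
         torsion_free (Ext G (padic_product \<alpha>))"
  using assms(1) topological_ab_group_padic_product continuously_divisible_padic_product
  by (intro conjI comm_group_Ext divisible_Ext torsion_free_Ext)

end
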